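(* Let $\mathbf{X}=(X_1,\ldots,X_N)^\intercal:(\Omega,\mathcal{F})\to(\mathbb{A}^N,\mathcal{B}^N)$ be a vector of $N\in\mathbb{N}$ input random variables satisfying the standing assumptions (1)-(3) listed in the context, let $\mathbf{p}\in\mathbb{N}_0^N$ and let $\boldsymbol{\Xi}=\{\boldsymbol{\xi}_1,\ldots,\boldsymbol{\xi}_N\}$ with $\boldsymbol{\xi}_k$ a $(p_k+1)$-open knot sequence on $[a_k,b_k]$. For every $\emptyset\neq u\subseteq\{1,\ldots,N\}$, the reduced set of multivariate orthonormal B-splines $\{\Psi^u_{\mathbf{i}_u,\mathbf{p}_u,\boldsymbol{\Xi}_u}(\mathbf{x}_u):\mathbf{i}_u\in\bar{\mathcal{I}}_{u,\mathbf{n}_u}\}$, consistent with the probability measure $f_{\mathbf{X}_u}(\mathbf{x}_u)\,d\mathbf{x}_u$, is a basis of $\bar{\mathcal{S}}^u_{\mathbf{p}_u,\boldsymbol{\Xi}_u}$, that is, \[ \bar{\mathcal{S}}^u_{\mathbf{p}_u,\boldsymbol{\Xi}_u}=\operatorname{span}\left\{\Psi^u_{\mathbf{i}_u,\mathbf{p}_u,\boldsymbol{\Xi}_u}(\mathbf{x}_u)\right\}_{\mathbf{i}_u\in\bar{\mathcal{I}}_{u,\mathbf{n}_u}}=\bigotimes_{k\in u}\operatorname{span}\left\{\psi^k_{i_k,p_k,\boldsymbol{\xi}_k}(x_k)\right\}_{i_k=2,\ldots,n_k}. \] Moreover, with $\boldsymbol{1}=\operatorname{span}\{1\}$ and $\oplus$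 denoting orthogonal sum with respect to the inner product of $L^2(\mathbb{A}^N,\mathcal{B}^N,f_{\mathbf{X}}d\mathbf{x})$, \[ \mathcal{S}_{\mathbf{p},\boldsymbol{\Xi}}=\boldsymbol{1}\oplus\bigoplus_{\emptyset\neq u\subseteq\{1,\ldots,N\}}\operatorname{span}\left\{\Psi^u_{\mathbf{i}_u,\mathbf{p}_u,\boldsymbol{\Xi}_u}(\mathbf{x}_u)\right\}_{\mathbf{i}_u\in\bar{\mathcal{I}}_{u,\mathbf{n}_u}}=\boldsymbol{1}\oplus\bigoplus_{\emptyset\neq u\subseteq\{1,\ldots,N\}}\ \bigotimes_{k\in u}\operatorname{span}\left\{\psi^k_{i_k,p_k,\boldsymbol{\xi}_k}(x_k)\right\}_{i_k=2,\ldots,n_k}. \]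
   Context: Notation: $\mathbb{N}=\{1,2,\ldots\}$, $\mathbb{N}_0=\mathbb{N}\cup\{0\}$. $(\Omega,\mathcal{F},\mathbb{P})$ is a probability space with expectation $\mathbb{E}$; for $k=1,\ldots,N$, $[a_k,b_k]\subset\mathbb{R}$ is a finite interval with $a_k<b_k$; $\mathbb{A}^N=\prod_{k=1}^N[a_k,b_k]$ with Borel $\sigma$-algebra $\mathcal{B}^N$. Standing assumptions on $\mathbf{X}$: (1) $X_1,\ldots,X_N$ are statistically independent, not necessarily identically distributed. (2) Each $X_k$ is defined on the bounded interval $[a_k,b_k]$, hence has finite moments of all orders. (3) Each $X_k$ has an absolutely continuous marginal distribution function and a continuous marginal probability density function $f_{X_k}$ with bounded support $[a_k,b_k]$. Hence $\mathbf{X}$ has joint density $f_{\mathbf{X}}(\mathbf{x})=\prod_{k=1}^N f_{X_k}(x_k)$ supported on $\mathbb{A}^N$. For $\emptyset\neq u=\{k_1,\ldots,k_{|u|}\}\subseteq\{1,\ldots,N\}$: $\mathbf{X}_u=(X_{k_1},\ldots,X_{k_{|u|}})^\intercal$, $\mathbf{x}_u=(x_{k_1},\ldots,x_{k_{|u|}})$, $f_{\mathbf{X}_u}(\mathbf{x}_u)=\prod_{k\in u}f_{X_k}(x_k)$, $\mathbf{p}_u=(p_k)_{k\in u}$, $\boldsymbol{\Xi}_u=\{\boldsymbol{\xi}_k\}_{k\in u}$, $\mathbf{n}_u=(n_k)_{k\in u}$. Knots: for $n_k>p_k\ge0$, a $(p_k+1)$-open knot sequence on $[a_k,b_k]$ is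 a non-decreasing sequence $\boldsymbol{\xi}_k=\{\xi_{k,i}\}_{i=1}^{n_k+p_k+1}$ with distinct values $a_k=\zeta_{k,1}<\cdots<\zeta_{k,r_k}=b_k$ of multiplicities $m_{k,1}=m_{k,r_k}=p_k+1$ and $1\le m_{k,j}\le p_k+1$ for $1<j<r_k$. B-splines: $B^k_{i,0,\boldsymbol{\xi}_k}(x)=1$ if $\xi_{k,i}\le x<\xi_{k,i+1}$ and $0$ otherwise; for $p\ge1$, $B^k_{i,p,\boldsymbol{\xi}_k}(x)=\frac{x-\xi_{k,i}}{\xi_{k,i+p}-\xi_{k,i}}B^k_{i,p-1,\boldsymbol{\xi}_k}(x)+\frac{\xi_{k,i+p+1}-x}{\xi_{k,i+p+1}-\xi_{k,i+1}}B^k_{i+1,p-1,\boldsymbol{\xi}_k}(x)$, with $0/0:=0$. The univariate spline space is $\mathcal{S}_{k,p_k,\boldsymbol{\xi}_k}=\operatorname{span}\{B^k_{i,p_k,\boldsymbol{\xi}_k}:1\le i\le n_k\}$, of dimension $n_k$. Functions equal almost everywhere are identified. Orthonormalized B-splines: let $\mathbf{P}_k(x_k)=(1,B^k_{2,p_k,\boldsymbol{\xi}_k}(x_k),\ldots,B^k_{n_k,p_k,\boldsymbol{\xi}_k}(x_k))^\intercal$, let $\mathbf{G}_k=\mathbb{E}[\mathbf{P}_k(X_k)\mathbf{P}_k^\intercal(X_k)]$ (symmetric positive-definite), with Cholesky factorization $\mathbf{G}_k=\mathbf{Q}_k\mathbf{Q}_k^\intercal$, $\mathbf{Q}_k$ lower-triangular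 with positive diagonal. Then $\boldsymbol{\psi}_k(x_k)=\mathbf{Q}_k^{-1}\mathbf{P}_k(x_k)$ has components $\psi^k_{i,p_k,\boldsymbol{\xi}_k}(x_k)$, $i=1,\ldots,n_k$. Multivariate splines and spaces: $\bar{\mathcal{I}}_{u,\mathbf{n}_u}=\{\mathbf{i}_u=(i_{k_1},\ldots,i_{k_{|u|}}):2\le i_{k_l}\le n_{k_l},\ 1\le l\le|u|\}$ and $\Psi^u_{\mathbf{i}_u,\mathbf{p}_u,\boldsymbol{\Xi}_u}(\mathbf{x}_u)=\prod_{k\in u}\psi^k_{i_k,p_k,\boldsymbol{\xi}_k}(x_k)$. Further, $\mathcal{S}_{\mathbf{p},\boldsymbol{\Xi}}=\bigotimes_{k=1}^N\mathcal{S}_{k,p_k,\boldsymbol{\xi}_k}$; $\bar{\mathcal{S}}_{k,p_k,\boldsymbol{\xi}_k}=\operatorname{span}\{\psi^k_{i_k,p_k,\boldsymbol{\xi}_k}:i_k=2,\ldots,n_k\}\subset\mathcal{S}_{k,p_k,\boldsymbol{\xi}_k}$; and $\bar{\mathcal{S}}^u_{\mathbf{p}_u,\boldsymbol{\Xi}_u}=\bigotimes_{k\in u}\bar{\mathcal{S}}_{k,p_k,\boldsymbol{\xi}_k}$. Tensor products are realized as spans of products of functions of the separate variables. *)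

theory Defs
  imports "HOL-Probability.Probability" "Jordan_Normal_Form.Gauss_Jordan_Elimination"
begin

subsection \<open>Knots and B-splines\<close>

text \<open>
  The knots are indexed from 1, so only the values of \<open>\<xi>\<close> on \<open>{1..n + p + 1}\<close> matter.
  The cardinality of \<open>{i. \<xi> i = z}\<close> is the multiplicity of the value \<open>z\<close>.
\<close>

definition open_knots :: "nat \<Rightarrow> nat \<Rightarrow> real \<Rightarrow> real \<Rightarrow> (nat \<Rightarrow> real) \<Rightarrow> bool" where
  "open_knots p n a b \<xi> \<longleftrightarrow>
     p < n \<and>
     (\<forall>i\<in>{1..n + p}. \<xi> i \<le> \<xi> (i + 1)) \<and>
     \<xi> 1 = a \<and> \<xi> (n + p + 1) = b \<and>
     card {i\<in>{1..n + p + 1}. \<xi> i = a} = p + 1 \<and>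
     card {i\<in>{1..n + p + 1}. \<xi> i = b} = p + 1 \<and>
     (\<forall>z. a < z \<and> z < b \<longrightarrow> card {i\<in>{1..n + p + 1}. \<xi> i = z} \<le> p + 1)"

text \<open>
  The convention \<open>0 / 0 = 0\<close> is that of division in HOL. Since the intervals are half-open,
  every \<open>bspline \<xi> p i\<close> vanishes at the last knot; this is immaterial because functions are
  identified almost everywhere below.
\<close>

fun bspline :: "(nat \<Rightarrow> real) \<Rightarrow> nat \<Rightarrow> nat \<Rightarrow> real \<Rightarrow> real" where
  "bspline \<xi> 0 i x = (if \<xi> i \<le> x \<and> x < \<xi> (i + 1) then 1 else 0)"
| "bspline \<xi> (Suc p) i x =
     (x - \<xi> i) / (\<xi> (i + Suc p) - \<xi> i) * bspline \<xi> p i x +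
     (\<xi> (i + Suc p + 1) - x) / (\<xi> (i + Suc p + 1) - \<xi> (i + 1)) * bspline \<xi> p (i + 1) x"


subsection \<open>Orthonormalized B-splines\<close>

text \<open>
  Vectors and matrices of the library are indexed from 0: entry \<open>j\<close> of \<open>aux_vec\<close> is
  component \<open>j + 1\<close> of \<open>(1, B\<^sub>2, \<dots>, B\<^sub>n)\<close>.
\<close>

definition aux_vec :: "(nat \<Rightarrow> real) \<Rightarrow> nat \<Rightarrow> nat \<Rightarrow> real \<Rightarrow> real vec" where
  "aux_vec \<xi> p n x = vec n (\<lambda>j. if j = 0 then 1 else bspline \<xi> p (j + 1) x)"

definition moment_mat :: "'w measure \<Rightarrow> ('w \<Rightarrow> real) \<Rightarrow> (nat \<Rightarrow> real) \<Rightarrow> nat \<Rightarrow> nat \<Rightarrow> real mat" where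
  "moment_mat M Y \<xi> p n =
     mat n n (\<lambda>(i, j). \<integral>\<omega>. vec_index (aux_vec \<xi> p n (Y \<omega>)) i * vec_index (aux_vec \<xi> p n (Y \<omega>)) j \<partial>M)"

definition is_cholesky :: "real mat \<Rightarrow> real mat \<Rightarrow> bool" where
  "is_cholesky G Q \<longleftrightarrow>
     Q \<in> carrier_mat (dim_row G) (dim_row G) \<and>
     (\<forall>i < dim_row G. \<forall>j < dim_row G. i < j \<longrightarrow> Q $$ (i, j) = 0) \<and>
     (\<forall>i < dim_row G. 0 < Q $$ (i, i)) \<and>
     G = Q * transpose_mat Q"

text \<open>The Cholesky factor of a symmetric positive-definite matrix exists and is unique.\<close>

definition cholesky :: "real mat \<Rightarrow> real mat" where
  "cholesky G = (SOME Q. is_cholesky G Q)"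

definition psi ::
  "'w measure \<Rightarrow> ('w \<Rightarrow> real) \<Rightarrow> (nat \<Rightarrow> real) \<Rightarrow> nat \<Rightarrow> nat \<Rightarrow> nat \<Rightarrow> real \<Rightarrow> real" where
  "psi M Y \<xi> p n i x =
     vec_index (the (mat_inverse (cholesky (moment_mat M Y \<xi> p n))) *\<^sub>v aux_vec \<xi> p n x) (i - 1)"

text \<open>
  The function reads only the coordinates in \<open>u\<close>, so that the same term denotes the function of
  \<open>x\<^sub>u\<close> and its extension to a function of all variables.
\<close>

definition Psi ::
  "'w measure \<Rightarrow> (nat \<Rightarrow> 'w \<Rightarrow> real) \<Rightarrow> (nat \<Rightarrow> nat \<Rightarrow> real) \<Rightarrow> (nat \<Rightarrow> nat) \<Rightarrow> (nat \<Rightarrow> nat) \<Rightarrow>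
   nat set \<Rightarrow> (nat \<Rightarrow> nat) \<Rightarrow> (nat \<Rightarrow> real) \<Rightarrow> real" where
  "Psi M X \<Xi> p n u i x = (\<Prod>k\<in>u. psi M (X k) (\<Xi> k) (p k) (n k) (i k) (x k))"

definition reduced_indices :: "(nat \<Rightarrow> nat) \<Rightarrow> nat set \<Rightarrow> (nat \<Rightarrow> nat) set" where
  "reduced_indices n u = (\<Pi>\<^sub>E k\<in>u. {2..n k})"


subsection \<open>Subspaces of \<open>L\<^sup>2\<close>\<close>

definition uni_measure :: "real \<Rightarrow> real \<Rightarrow> (real \<Rightarrow> real) \<Rightarrow> real measure" where
  "uni_measure a b f = density (restrict_space lborel {a..b}) (\<lambda>x. ennreal (f x))"

definition joint_measure ::
  "(nat \<Rightarrow> real) \<Rightarrow> (nat \<Rightarrow> real) \<Rightarrow> (nat \<Rightarrow> real \<Rightarrow> real) \<Rightarrow> nat set \<Rightarrow> (nat \<Rightarrow> real) measure" where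
  "joint_measure a b f u =
     density (\<Pi>\<^sub>M k\<in>u. restrict_space lborel {a k..b k}) (\<lambda>x. ennreal (\<Prod>k\<in>u. f k (x k)))"

text \<open>
  A subspace of \<open>L\<^sup>2(\<mu>)\<close> is represented by the set of all measurable representatives of its
  elements. Such sets are closed under almost-everywhere equality, so that equality of sets is
  equality of subspaces of \<open>L\<^sup>2(\<mu>)\<close>.
\<close>

definition L2 :: "'a measure \<Rightarrow> ('a \<Rightarrow> real) set" where
  "L2 \<mu> = {g \<in> borel_measurable \<mu>. integrable \<mu> (\<lambda>x. (g x)\<^sup>2)}"

definition L2_inner :: "'a measure \<Rightarrow> ('a \<Rightarrow> real) \<Rightarrow> ('a \<Rightarrow> real) \<Rightarrow> real" where
  "L2_inner \<mu> g h = (\<integral>x. g x * h x \<partial>\<mu>)"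

definition ae_span :: "'a measure \<Rightarrow> ('a \<Rightarrow> real) set \<Rightarrow> ('a \<Rightarrow> real) set" where
  "ae_span \<mu> F =
     {g \<in> borel_measurable \<mu>.
        \<exists>T c. finite T \<and> T \<subseteq> F \<and> (AE x in \<mu>. g x = (\<Sum>h\<in>T. c h * h x))}"

definition ae_basis ::
  "'a measure \<Rightarrow> 'i set \<Rightarrow> ('i \<Rightarrow> 'a \<Rightarrow> real) \<Rightarrow> ('a \<Rightarrow> real) set \<Rightarrow> bool" where
  "ae_basis \<mu> I e V \<longleftrightarrow>
     finite I \<and>
     (\<forall>c. (AE x in \<mu>. (\<Sum>i\<in>I. c i * e i x) = 0) \<longrightarrow> (\<forall>i\<in>I. c i = 0)) \<and>
     V = ae_span \<mu> (e ` I)"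

definition tensor ::
  "(nat \<Rightarrow> real) measure \<Rightarrow> nat set \<Rightarrow> (nat \<Rightarrow> (real \<Rightarrow> real) set) \<Rightarrow> ((nat \<Rightarrow> real) \<Rightarrow> real) set" where
  "tensor \<mu> u V = ae_span \<mu> {\<lambda>x. \<Prod>k\<in>u. h k (x k) | h. \<forall>k\<in>u. h k \<in> V k}"

text \<open>
  For a finite index set \<open>I\<close>: \<open>S\<close> is the sum of the pairwise orthogonal subspaces \<open>V i\<close>.
\<close>

definition is_orthogonal_sum ::
  "'a measure \<Rightarrow> 'i set \<Rightarrow> ('i \<Rightarrow> ('a \<Rightarrow> real) set) \<Rightarrow> ('a \<Rightarrow> real) set \<Rightarrow> bool" where
  "is_orthogonal_sum \<mu> I V S \<longleftrightarrow>
     (\<forall>i\<in>I. V i \<subseteq> L2 \<mu>) \<and>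
     (\<forall>i\<in>I. \<forall>j\<in>I. i \<noteq> j \<longrightarrow> (\<forall>g\<in>V i. \<forall>h\<in>V j. L2_inner \<mu> g h = 0)) \<and>
     S = {g \<in> borel_measurable \<mu>.
            \<exists>h. (\<forall>i\<in>I. h i \<in> V i) \<and> (AE x in \<mu>. g x = (\<Sum>i\<in>I. h i x))}"


subsection \<open>Spline spaces\<close>

definition spline_space ::
  "real \<Rightarrow> real \<Rightarrow> (real \<Rightarrow> real) \<Rightarrow> (nat \<Rightarrow> real) \<Rightarrow> nat \<Rightarrow> nat \<Rightarrow> (real \<Rightarrow> real) set" where
  "spline_space a b f \<xi> p n = ae_span (uni_measure a b f) ((\<lambda>i. bspline \<xi> p i) ` {1..n})"

definition psi_span ::
  "'w measure \<Rightarrow> ('w \<Rightarrow> real) \<Rightarrow> real \<Rightarrow> real \<Rightarrow> (real \<Rightarrow> real) \<Rightarrow> (nat \<Rightarrow> real) \<Rightarrow> nat \<Rightarrow> nat \<Rightarrow>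
   (real \<Rightarrow> real) set" where
  "psi_span M Y a b f \<xi> p n = ae_span (uni_measure a b f) ((\<lambda>i. psi M Y \<xi> p n i) ` {2..n})"

definition full_spline_space ::
  "nat \<Rightarrow> (nat \<Rightarrow> real) \<Rightarrow> (nat \<Rightarrow> real) \<Rightarrow> (nat \<Rightarrow> real \<Rightarrow> real) \<Rightarrow> (nat \<Rightarrow> nat \<Rightarrow> real) \<Rightarrow>
   (nat \<Rightarrow> nat) \<Rightarrow> (nat \<Rightarrow> nat) \<Rightarrow> ((nat \<Rightarrow> real) \<Rightarrow> real) set" where
  "full_spline_space N a b f \<Xi> p n =
     tensor (joint_measure a b f {1..N}) {1..N}
       (\<lambda>k. spline_space (a k) (b k) (f k) (\<Xi> k) (p k) (n k))"

text \<open>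
  The zero-mean space in the variables \<open>x\<^sub>u\<close>, as a space of functions on the product of the
  intervals with index in \<open>u\<close>.
\<close>

definition reduced_spline_space ::
  "'w measure \<Rightarrow> (nat \<Rightarrow> 'w \<Rightarrow> real) \<Rightarrow> (nat \<Rightarrow> real) \<Rightarrow> (nat \<Rightarrow> real) \<Rightarrow> (nat \<Rightarrow> real \<Rightarrow> real) \<Rightarrow>
   (nat \<Rightarrow> nat \<Rightarrow> real) \<Rightarrow> (nat \<Rightarrow> nat) \<Rightarrow> (nat \<Rightarrow> nat) \<Rightarrow> nat set \<Rightarrow> ((nat \<Rightarrow> real) \<Rightarrow> real) set" where
  "reduced_spline_space M X a b f \<Xi> p n u =
     tensor (joint_measure a b f u) u
       (\<lambda>k. psi_span M (X k) (a k) (b k) (f k) (\<Xi> k) (p k) (n k))"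

end

theory Submission
  imports Defs "Jordan_Normal_Form.Determinant"
begin

text \<open>
  The Cholesky factorization of the moment matrix performs the Gram-Schmidt process on
  \<open>(1, B\<^sub>2, \<dots>, B\<^sub>n)\<close>. Its first step leaves the constant alone, so \<open>\<psi>\<^sub>1 = 1\<close>, and
  \<open>\<psi>\<^sub>1, \<dots>, \<psi>\<^sub>n\<close> is an orthonormal basis of the univariate spline space. Hence each univariate
  space is the orthogonal sum of the constants and of the zero-mean span of \<open>\<psi>\<^sub>2, \<dots>, \<psi>\<^sub>n\<close>.

  Multiplying these splittings out over the coordinates gives the theorem. A product of functions
  \<open>\<psi>\<close>, one for each of the \<open>N\<close> coordinates, has the factor 1 at every coordinate with index 1, so
  it equals \<open>\<Psi>\<^sup>u\<close> for the set \<open>u\<close> of the coordinates whose index is at least 2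
  (\<open>full_products\<close>). The functions \<open>\<Psi>\<^sup>u\<close> with index tuple \<open>i\<close>, for all \<open>u\<close> and \<open>i\<close> together, are therefore a
  relabelling of one family over a box of indices. That family spans the tensor product of the
  univariate spaces (\<open>tensor_ae_span\<close>), and it is orthonormal because the joint measure is the product
  of the marginals and integrals of products factorize (\<open>product_orthonormal\<close>). Grouping
  it by \<open>u\<close> gives the orthogonal sum (\<open>orthogonal_blocks_orthogonal_sum\<close>); the members with
  a fixed \<open>u\<close>, taken on the variables in \<open>u\<close> alone, give the basis (\<open>orthonormal_ae_basis\<close>).

  For this to make sense the moment matrix must be positive definite; only then does a Cholesky
  factor exist (\<open>cholesky_factors_exist\<close>) and is \<open>\<psi>\<close> what its name says. Positive definiteness means
  that \<open>1, B\<^sub>2, \<dots>, B\<^sub>n\<close> are linearly independent modulo null sets of \<open>f dx\<close>. As the B-splines sum to 1,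
  this reduces to the independence of \<open>B\<^sub>1, \<dots>, B\<^sub>n\<close> (\<open>bspline_ae_independent\<close>). The density may
  vanish on a set of positive Lebesgue measure, so \<open>f dx\<close> need not be equivalent to Lebesgue
  measure on \<open>[a, b]\<close>. But \<open>f\<close> is continuous and its support is all of \<open>[a, b]\<close>, so every nonempty knot
  interval contains a nonempty open set \<open>J\<close> on which \<open>f > 0\<close>. The splines are continuous on \<open>J\<close>, so a
  relation that holds almost everywhere holds at every point of \<open>J\<close>. The \<open>p + 1\<close> B-splines living
  there are independent on any such \<open>J\<close> (\<open>bspline_locally_independent\<close>): differentiating a vanishing
  combination lowers the degree and forces all coefficients to agree, and then the partition of
  unity forces them to be 0.
\<close>

section \<open>B-splines on a single knot interval\<close>

lemma bspline_local_support:
  assumes "mono_on {i..i + p + 1} \<xi>" and "x < \<xi> i \<or> \<xi> (i + p + 1) \<le> x"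
  shows "bspline \<xi> p i x = 0"
  using assms
proof (induction p arbitrary: i)
  case 0
  then show ?case by auto
next
  case (Suc p)
  have le: "\<xi> i \<le> \<xi> (i + 1)" "\<xi> (i + p + 1) \<le> \<xi> (i + p + 2)"
    by (auto intro!: mono_onD[OF Suc.prems(1)])
  have "bspline \<xi> p i x = 0"
    using Suc.prems le by (intro Suc.IH) (auto intro: mono_on_subset)
  moreover have "bspline \<xi> p (i + 1) x = 0"
    using Suc.prems le by (intro Suc.IH) (auto intro: mono_on_subset)
  ultimately show ?case by simp
qed

text \<open>
  Both the recursion and the derivative formula express a B-spline of degree \<open>p + 1\<close> as a term in
  the B-spline of degree \<open>p\<close> at the same index plus one at the next index. Collecting a linear combination
  by B-splines of degree \<open>p\<close> is an index shift; the two boundary terms vanish because the outermost B-splines of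
  degree \<open>p\<close> are 0 on the knot interval under consideration.
\<close>

lemma sum_telescoping_pairs:
  fixes c A B :: "nat \<Rightarrow> real"
  assumes "A 0 = 0" and "B (p + 2) = 0"
  shows "(\<Sum>t\<le>Suc p. c t * (A t + B (Suc t))) = (\<Sum>t\<le>p. c (Suc t) * A (Suc t) + c t * B (Suc t))"
proof -
  have "(\<Sum>t\<le>Suc p. c t * A t) = (\<Sum>t\<le>p. c (Suc t) * A (Suc t))"
    using assms(1) by (subst sum.atMost_Suc_shift) simp
  moreover have "(\<Sum>t\<le>Suc p. c t * B (Suc t)) = (\<Sum>t\<le>p. c t * B (Suc t))"
    using assms(2) by (simp add: numeral_2_eq_2)
  ultimately show ?thesis
    by (simp only: distrib_left sum.distrib)
qed

text \<open>
  The \<open>p + 1\<close> B-splines that do not vanish on the knot interval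
  \<open>[\<xi> (l + p), \<xi> (l + p + 1))\<close> are those with indices \<open>l, \<dots>, l + p\<close>. In the recursion the two weights
  that multiply one B-spline of lower degree add up to 1, so the degree can be lowered down to 0.
\<close>

lemma bspline_partition_of_unity_local:
  assumes "mono_on {l..l + 2 * p + 1} \<xi>" and "\<xi> (l + p) \<le> x" and "x < \<xi> (l + p + 1)"
  shows "(\<Sum>t\<le>p. bspline \<xi> p (l + t) x) = 1"
  using assms
proof (induction p arbitrary: l)
  case 0
  then show ?case by simp
next
  case (Suc p)
  define A where "A t = (x - \<xi> (l + t)) / (\<xi> (l + t + Suc p) - \<xi> (l + t)) * bspline \<xi> p (l + t) x" for t
  define B where "B t = (\<xi> (l + t + Suc p) - x) / (\<xi> (l + t + Suc p) - \<xi> (l + t)) * bspline \<xi> p (l + t) x" for t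
  have "bspline \<xi> p l x = 0"
    using Suc.prems by (intro bspline_local_support) (auto intro: mono_on_subset)
  hence A0: "A 0 = 0" by (simp add: A_def)
  have "bspline \<xi> p (l + (p + 2)) x = 0"
    using Suc.prems by (intro bspline_local_support) (auto intro: mono_on_subset)
  hence B0: "B (p + 2) = 0" by (simp add: B_def)
  have AB: "A (Suc t) + B (Suc t) = bspline \<xi> p (l + 1 + t) x" if "t \<le> p" for t
  proof -
    have "\<xi> (l + Suc t) \<le> \<xi> (l + Suc p)" "\<xi> (l + Suc p + 1) \<le> \<xi> (l + Suc t + Suc p)"
      using that by (auto intro!: mono_onD[OF Suc.prems(1)])
    hence "\<xi> (l + Suc t + Suc p) - \<xi> (l + Suc t) \<noteq> 0" using Suc.prems by linarith
    moreover have "A (Suc t) + B (Suc t)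
      = (\<xi> (l + Suc t + Suc p) - \<xi> (l + Suc t)) / (\<xi> (l + Suc t + Suc p) - \<xi> (l + Suc t)) * bspline \<xi> p (l + Suc t) x"
      unfolding A_def B_def by (simp add: distrib_right[symmetric] add_divide_distrib[symmetric])
    ultimately show ?thesis by simp
  qed
  have "(\<Sum>t\<le>Suc p. bspline \<xi> (Suc p) (l + t) x) = (\<Sum>t\<le>Suc p. 1 * (A t + B (Suc t)))"
    by (intro sum.cong refl) (simp add: A_def B_def ac_simps)
  also have "\<dots> = (\<Sum>t\<le>p. 1 * A (Suc t) + 1 * B (Suc t))"
    by (rule sum_telescoping_pairs[where A = A and B = B, OF A0 B0])
  also have "\<dots> = (\<Sum>t\<le>p. bspline \<xi> p (l + 1 + t) x)"
    by (intro sum.cong refl) (simp only: mult_1 AB atMost_iff)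
  also have "\<dots> = 1"
    using Suc.prems by (intro Suc.IH) (auto intro: mono_on_subset)
  finally show ?case .
qed

text \<open>
  Induction over the degree. Both sides are combinations of three B-splines of lower degree. The
  coefficients of the outer two agree, and those of the middle one agree because a knot difference
  divided by itself is 1. With the convention \<open>0 / 0 = 0\<close> such a quotient may instead be 0, but then the
  knots in between coincide too and the middle quotient is itself 0.
\<close>

lemma bspline_has_derivative:
  assumes "mono_on {i..i + p + 2} \<xi>" and "\<And>j. j \<in> {i..i + p + 2} \<Longrightarrow> \<xi> j \<noteq> x"
  shows "(bspline \<xi> (Suc p) i has_real_derivative
           real (Suc p) * (bspline \<xi> p i x / (\<xi> (i + Suc p) - \<xi> i)
             - bspline \<xi> p (i + 1) x / (\<xi> (i + p + 2) - \<xi> (i + 1)))) (at x)"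
  using assms
proof (induction p arbitrary: i)
  case 0
  have step: "(bspline \<xi> 0 j has_real_derivative 0) (at x)" if "\<xi> j \<noteq> x" "\<xi> (j + 1) \<noteq> x" for j
  proof -
    have "open (- {\<xi> j, \<xi> (j + 1)})" by (intro open_Compl finite_imp_closed) auto
    moreover have "x \<in> - {\<xi> j, \<xi> (j + 1)}" using that by auto
    ultimately obtain e where e: "e > 0" "ball x e \<subseteq> - {\<xi> j, \<xi> (j + 1)}"
      by (rule openE)
    have locally_const: "bspline \<xi> 0 j x = bspline \<xi> 0 j y" if "y \<in> ball x e" for y
    proof -
      have "closed_segment x y \<subseteq> ball x e"
        using that e(1) by (intro closed_segment_subset) auto
      hence "\<xi> j \<notin> closed_segment x y" "\<xi> (j + 1) \<notin> closed_segment x y" using e(2) by auto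
      thus ?thesis by (auto simp: closed_segment_eq_real_ivl split: if_splits)
    qed
    show ?thesis
      by (rule has_field_derivative_transform_within_open[OF DERIV_const[of "bspline \<xi> 0 j x"]
            open_ball[of x e] _ locally_const]) (use e in auto)
  qed
  have nz: "\<xi> i \<noteq> x" "\<xi> (i + 1) \<noteq> x" "\<xi> (i + 1 + 1) \<noteq> x" using 0 by auto
  define a1 a2 where "a1 = 1 / (\<xi> (i + 1) - \<xi> i)" and "a2 = 1 / (\<xi> (i + 2) - \<xi> (i + 1))"
  have unf: "bspline \<xi> (Suc 0) i = (\<lambda>x. (x - \<xi> i) * a1 * bspline \<xi> 0 i x
       + (\<xi> (i + 2) - x) * a2 * bspline \<xi> 0 (i + 1) x)"
    unfolding bspline.simps(2)[of \<xi> 0] by (simp add: fun_eq_iff a1_def a2_def eval_nat_numeral)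
  have "(bspline \<xi> (Suc 0) i has_real_derivative
      a1 * bspline \<xi> 0 i x - a2 * bspline \<xi> 0 (i + 1) x) (at x)"
    unfolding unf by (rule derivative_eq_intros step nz refl | simp del: bspline.simps)+
  thus ?case by (simp add: a1_def a2_def eval_nat_numeral del: bspline.simps)
next
  case (Suc p)
  define a1 a2 where "a1 = 1 / (\<xi> (i + Suc (Suc p)) - \<xi> i)"
    and "a2 = 1 / (\<xi> (i + p + 3) - \<xi> (i + 1))"
  define b0 b1 b2 where "b0 = bspline \<xi> p i x / (\<xi> (i + Suc p) - \<xi> i)"
    and "b1 = bspline \<xi> p (i + 1) x / (\<xi> (i + p + 2) - \<xi> (i + 1))"
    and "b2 = bspline \<xi> p (i + 2) x / (\<xi> (i + p + 3) - \<xi> (i + 2))"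
  have d0: "(bspline \<xi> (Suc p) i has_real_derivative real (Suc p) * (b0 - b1)) (at x)"
    unfolding b0_def b1_def using Suc.prems by (intro Suc.IH) (auto intro: mono_on_subset)
  have "(bspline \<xi> (Suc p) (i + 1) has_real_derivative
          real (Suc p) * (bspline \<xi> p (i + 1) x / (\<xi> (i + 1 + Suc p) - \<xi> (i + 1))
             - bspline \<xi> p (i + 1 + 1) x / (\<xi> (i + 1 + p + 2) - \<xi> (i + 1 + 1)))) (at x)"
    using Suc.prems by (intro Suc.IH) (auto intro: mono_on_subset)
  hence d1: "(bspline \<xi> (Suc p) (i + 1) has_real_derivative real (Suc p) * (b1 - b2)) (at x)"
    by (simp add: b1_def b2_def eval_nat_numeral)
  have unf: "bspline \<xi> (Suc (Suc p)) i = (\<lambda>x. (x - \<xi> i) * a1 * bspline \<xi> (Suc p) i x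
       + (\<xi> (i + p + 3) - x) * a2 * bspline \<xi> (Suc p) (i + 1) x)"
    unfolding bspline.simps(2)[of \<xi> "Suc p"] by (simp add: fun_eq_iff a1_def a2_def eval_nat_numeral)
  have "(bspline \<xi> (Suc (Suc p)) i has_real_derivative
      (a1 * bspline \<xi> (Suc p) i x + (x - \<xi> i) * a1 * (real (Suc p) * (b0 - b1))) +
      (- a2 * bspline \<xi> (Suc p) (i + 1) x + (\<xi> (i + p + 3) - x) * a2 * (real (Suc p) * (b1 - b2)))) (at x)"
    unfolding unf by (rule derivative_eq_intros d0 d1 refl | simp)+
  moreover
  have e0: "bspline \<xi> (Suc p) i x = (x - \<xi> i) * b0 + (\<xi> (i + p + 2) - x) * b1"
    by (simp add: b0_def b1_def)
  have e1: "bspline \<xi> (Suc p) (i + 1) x = (x - \<xi> (i + 1)) * b1 + (\<xi> (i + p + 3) - x) * b2"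
    by (simp add: b1_def b2_def eval_nat_numeral)
  \<comment> \<open>The only place where a vanishing denominator matters.\<close>
  have key: "b1 * ((\<xi> (i + p + 2) - \<xi> i) * a1) = b1 * ((\<xi> (i + p + 3) - \<xi> (i + 1)) * a2)"
  proof (cases "\<xi> (i + p + 2) = \<xi> (i + 1)")
    case True
    then show ?thesis by (simp add: b1_def)
  next
    case False
    have "\<xi> i \<le> \<xi> (i + 1)" "\<xi> (i + 1) \<le> \<xi> (i + p + 2)" "\<xi> (i + p + 2) \<le> \<xi> (i + p + 3)"
      by (auto intro!: mono_onD[OF Suc.prems(1)])
    with False show ?thesis by (simp add: a1_def a2_def)
  qed
  have "(a1 * bspline \<xi> (Suc p) i x + (x - \<xi> i) * a1 * (real (Suc p) * (b0 - b1))) +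
      (- a2 * bspline \<xi> (Suc p) (i + 1) x + (\<xi> (i + p + 3) - x) * a2 * (real (Suc p) * (b1 - b2)))
      = real (Suc (Suc p)) * (bspline \<xi> (Suc p) i x * a1 - bspline \<xi> (Suc p) (i + 1) x * a2)
        + real (Suc p) * (b1 * ((\<xi> (i + p + 3) - \<xi> (i + 1)) * a2) - b1 * ((\<xi> (i + p + 2) - \<xi> i) * a1))"
    unfolding e0 e1 of_nat_Suc by (simp add: algebra_simps)
  hence "(a1 * bspline \<xi> (Suc p) i x + (x - \<xi> i) * a1 * (real (Suc p) * (b0 - b1))) +
      (- a2 * bspline \<xi> (Suc p) (i + 1) x + (\<xi> (i + p + 3) - x) * a2 * (real (Suc p) * (b1 - b2)))
      = real (Suc (Suc p)) * (bspline \<xi> (Suc p) i x * a1 - bspline \<xi> (Suc p) (i + 1) x * a2)"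
    by (simp only: key diff_self mult_zero_right add_0_right)
  ultimately have "(bspline \<xi> (Suc (Suc p)) i has_real_derivative
      real (Suc (Suc p)) * (bspline \<xi> (Suc p) i x * a1 - bspline \<xi> (Suc p) (i + 1) x * a2)) (at x)"
    by (simp only:)
  thus ?case
    by (simp add: a1_def a2_def eval_nat_numeral del: bspline.simps of_nat_Suc)
qed

text \<open>
  The derivative of a vanishing combination is a vanishing combination of B-splines of lower
  degree, whose coefficients are multiples of the differences of consecutive coefficients. By
  induction all coefficients agree, and the partition of unity makes the common value 0. The set
  \<open>J\<close> is an arbitrary nonempty open subset of the knot interval because the density
  may vanish on the rest of it.
\<close>

lemma bspline_locally_independent:
  assumes "mono_on {l..l + 2 * p + 1} \<xi>"
    and "open J" and "J \<noteq> {}" and "J \<subseteq> {\<xi> (l + p)<..<\<xi> (l + p + 1)}"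
    and "\<And>x. x \<in> J \<Longrightarrow> (\<Sum>t\<le>p. c t * bspline \<xi> p (l + t) x) = 0"
    and "t \<le> p"
  shows "c t = 0"
  using assms
proof (induction p arbitrary: l c t)
  case 0
  then obtain x where "x \<in> J" by auto
  with 0 have "c 0 * bspline \<xi> 0 l x = 0" "\<xi> l < x" "x < \<xi> (l + 1)" by force+
  with 0 show ?case by simp
next
  case (Suc p)
  note mono = mono_onD[OF Suc.prems(1)]
  define D where "D t = \<xi> (l + t + Suc p) - \<xi> (l + t)" for t
  have zero: "(\<Sum>t\<le>p. (c (Suc t) - c t) / D (Suc t) * bspline \<xi> p (l + 1 + t) x) = 0" if "x \<in> J" for x
  proof -
    have x: "\<xi> (l + Suc p) < x" "x < \<xi> (l + Suc p + 1)" using that Suc.prems(4) by auto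
    have nk: "\<xi> j \<noteq> x" if "j \<in> {l..l + 2 * Suc p + 1}" for j
      using x mono[of j "l + Suc p"] mono[of "l + Suc p + 1" j] that by (cases "j \<le> l + Suc p") auto
    define A where "A t = bspline \<xi> p (l + t) x / D t" for t
    have "bspline \<xi> p l x = 0"
      using Suc.prems x by (intro bspline_local_support) (auto intro: mono_on_subset)
    hence A0: "A 0 = 0" by (simp add: A_def)
    have "bspline \<xi> p (l + (p + 2)) x = 0"
      using Suc.prems x by (intro bspline_local_support) (auto intro: mono_on_subset)
    hence B0: "- A (p + 2) = 0" by (simp add: A_def)
    have "(bspline \<xi> (Suc p) (l + t) has_real_derivative real (Suc p) * (A t + - A (Suc t))) (at x)"
      if "t \<le> Suc p" for t
    proof -
      have "mono_on {l + t..l + t + p + 2} \<xi>"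
        by (rule mono_on_subset[OF Suc.prems(1)]) (use that in auto)
      moreover have "\<xi> j \<noteq> x" if "j \<in> {l + t..l + t + p + 2}" for j
        by (rule nk) (use that \<open>t \<le> Suc p\<close> in auto)
      ultimately show ?thesis
        using bspline_has_derivative[of "l + t" p \<xi> x] by (simp add: A_def D_def)
    qed
    hence "((\<lambda>x. \<Sum>t\<le>Suc p. c t * bspline \<xi> (Suc p) (l + t) x) has_real_derivative
        (\<Sum>t\<le>Suc p. c t * (real (Suc p) * (A t + - A (Suc t))))) (at x)"
      by (intro DERIV_sum DERIV_cmult) (auto simp del: bspline.simps)
    moreover have "((\<lambda>x. \<Sum>t\<le>Suc p. c t * bspline \<xi> (Suc p) (l + t) x) has_real_derivative 0) (at x)"
      by (rule has_field_derivative_transform_within_open[OF DERIV_const[of 0] Suc.prems(2) that])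
         (simp only: Suc.prems(5))
    ultimately have "0 = (\<Sum>t\<le>Suc p. c t * (real (Suc p) * (A t + - A (Suc t))))"
      using DERIV_unique by blast
    also have "\<dots> = real (Suc p) * (\<Sum>t\<le>Suc p. c t * (A t + - A (Suc t)))"
      by (simp only: sum_distrib_left mult.left_commute)
    also have "(\<Sum>t\<le>Suc p. c t * (A t + - A (Suc t))) = (\<Sum>t\<le>p. c (Suc t) * A (Suc t) + c t * - A (Suc t))"
      by (rule sum_telescoping_pairs[where A = A and B = "\<lambda>t. - A t", OF A0 B0])
    also have "\<dots> = (\<Sum>t\<le>p. (c (Suc t) - c t) / D (Suc t) * bspline \<xi> p (l + 1 + t) x)"
      by (intro sum.cong refl) (simp add: A_def algebra_simps diff_divide_distrib)
    finally show ?thesis by simp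
  qed
  have eq: "c (Suc t) = c t" if t: "t \<le> p" for t
  proof -
    obtain x where "x \<in> J" using Suc.prems(3) by auto
    hence "\<xi> (l + Suc p) < x" "x < \<xi> (l + Suc p + 1)" using Suc.prems(4) by auto
    moreover have "\<xi> (l + Suc t) \<le> \<xi> (l + Suc p)" "\<xi> (l + Suc p + 1) \<le> \<xi> (l + Suc t + Suc p)"
      using t by (auto intro!: mono)
    ultimately have "D (Suc t) \<noteq> 0" by (simp add: D_def)
    moreover have "(c (Suc t) - c t) / D (Suc t) = 0"
      by (rule Suc.IH[where l = "l + 1" and c = "\<lambda>t. (c (Suc t) - c t) / D (Suc t)", OF _ Suc.prems(2,3) _ zero t])
         (use Suc.prems(1,4) in \<open>auto intro: mono_on_subset\<close>)
    ultimately show ?thesis by simp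
  qed
  have const: "c 0 = c t" if "t \<le> Suc p" for t
    using that by (induction t) (auto simp: eq)
  obtain x where x: "x \<in> J" using Suc.prems(3) by auto
  have "0 = (\<Sum>t\<le>Suc p. c t * bspline \<xi> (Suc p) (l + t) x)"
    using Suc.prems(5) x by simp
  also have "\<dots> = (\<Sum>t\<le>Suc p. c 0 * bspline \<xi> (Suc p) (l + t) x)"
    by (intro sum.cong refl) (simp only: atMost_iff const)
  also have "\<dots> = c 0 * (\<Sum>t\<le>Suc p. bspline \<xi> (Suc p) (l + t) x)"
    by (simp only: sum_distrib_left)
  also have "(\<Sum>t\<le>Suc p. bspline \<xi> (Suc p) (l + t) x) = 1"
    using Suc.prems(1,4) x by (intro bspline_partition_of_unity_local) auto
  finally show ?case using const[OF Suc.prems(6)] by simp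
qed

section \<open>Open knot sequences\<close>

lemma open_knots_mono:
  assumes "open_knots p n a b \<xi>"
  shows "mono_on {1..n + p + 1} \<xi>"
proof (rule mono_onI)
  fix i j assume i: "i \<in> {1..n + p + 1}" and j: "j \<in> {1..n + p + 1}" and "i \<le> j"
  from \<open>i \<le> j\<close> j show "\<xi> i \<le> \<xi> j"
  proof (induction rule: dec_induct)
    case base
    show ?case by simp
  next
    case (step k)
    hence "\<xi> k \<le> \<xi> (k + 1)" using assms i unfolding open_knots_def by auto
    moreover have "\<xi> i \<le> \<xi> k" using step i by (intro step.IH) auto
    ultimately show ?case by simp
  qed
qed

text \<open>
  A value of multiplicity \<open>p + 1\<close> in a monotone sequence occupies \<open>p + 1\<close> consecutive places, at the
  beginning if it is the least value and at the end if it is the greatest.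
\<close>

lemma open_knots_boundary:
  assumes "open_knots p n a b \<xi>"
  shows "\<xi> (p + 1) = a" and "\<xi> (n + 1) = b"
proof -
  note mono = mono_onD[OF open_knots_mono[OF assms]]
  have k: "p < n" "\<xi> 1 = a" "\<xi> (n + p + 1) = b"
      "card {i\<in>{1..n + p + 1}. \<xi> i = a} = p + 1" "card {i\<in>{1..n + p + 1}. \<xi> i = b} = p + 1"
    using assms by (auto simp: open_knots_def)
  show "\<xi> (p + 1) = a"
  proof (rule ccontr)
    assume "\<xi> (p + 1) \<noteq> a"
    moreover have "\<xi> 1 \<le> \<xi> (p + 1)" using k(1) by (intro mono) auto
    ultimately have "a < \<xi> (p + 1)" using k(2) by simp
    hence "{i\<in>{1..n + p + 1}. \<xi> i = a} \<subseteq> {1..p}"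
      using mono[of "p + 1"] k(1) by (force simp: not_less_eq_eq[symmetric])
    hence "card {i\<in>{1..n + p + 1}. \<xi> i = a} \<le> p" using card_mono[of "{1..p}"] by fastforce
    thus False using k by simp
  qed
  show "\<xi> (n + 1) = b"
  proof (rule ccontr)
    assume "\<xi> (n + 1) \<noteq> b"
    moreover have "\<xi> (n + 1) \<le> \<xi> (n + p + 1)" by (intro mono) auto
    ultimately have less: "\<xi> (n + 1) < b" using k(3) by simp
    have "{i\<in>{1..n + p + 1}. \<xi> i = b} \<subseteq> {n + 2..n + p + 1}"
    proof
      fix i assume i: "i \<in> {i\<in>{1..n + p + 1}. \<xi> i = b}"
      have "\<not> i \<le> n + 1"
      proof
        assume "i \<le> n + 1"
        with i have "\<xi> i \<le> \<xi> (n + 1)" by (intro mono) auto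
        with i less show False by simp
      qed
      with i show "i \<in> {n + 2..n + p + 1}" by auto
    qed
    hence "card {i\<in>{1..n + p + 1}. \<xi> i = b} \<le> card {n + 2..n + p + 1}" by (intro card_mono) auto
    thus False using k by simp
  qed
qed

text \<open>
  Otherwise \<open>p + 2\<close> knots would coincide, which exceeds every admissible multiplicity.
\<close>

lemma open_knots_support_nonempty:
  assumes "open_knots p n a b \<xi>" and "i \<in> {1..n}"
  shows "\<xi> i < \<xi> (i + p + 1)"
proof (rule ccontr)
  assume neg: "\<not> \<xi> i < \<xi> (i + p + 1)"
  note mono = mono_onD[OF open_knots_mono[OF assms(1)]]
  have "{i..i + p + 1} \<subseteq> {j\<in>{1..n + p + 1}. \<xi> j = \<xi> i}"
  proof
    fix j assume j: "j \<in> {i..i + p + 1}"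
    have "\<xi> i \<le> \<xi> j" "\<xi> j \<le> \<xi> (i + p + 1)" using j assms(2) by (auto intro!: mono)
    with j assms(2) neg show "j \<in> {j\<in>{1..n + p + 1}. \<xi> j = \<xi> i}" by auto
  qed
  hence "card {i..i + p + 1} \<le> card {j\<in>{1..n + p + 1}. \<xi> j = \<xi> i}" by (intro card_mono) auto
  hence "p + 1 < card {j\<in>{1..n + p + 1}. \<xi> j = \<xi> i}" by simp
  moreover have "\<xi> 1 \<le> \<xi> i" "\<xi> i \<le> \<xi> (n + p + 1)" using assms(2) by (auto intro!: mono)
  ultimately show False
    using assms(1) unfolding open_knots_def
    by (cases "\<xi> i = a"; cases "\<xi> i = b") (auto simp: not_le[symmetric])
qed

text \<open>
  The first and the last \<open>p + 1\<close> knots coincide, so a nonempty knot interval has at least \<open>p\<close> further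
  knots on either side. This is why all \<open>p + 1\<close> B-splines that live on it have an index between 1 and \<open>n\<close>.
\<close>

lemma open_knots_span:
  assumes "open_knots p n a b \<xi>" and "a \<le> x" and "x < b"
  obtains l where "1 \<le> l" and "l + p \<le> n" and "\<xi> (l + p) \<le> x" and "x < \<xi> (l + p + 1)"
proof -
  define S where "S = {j \<in> {p + 1..n}. \<xi> j \<le> x}"
  have fin: "finite S" by (simp add: S_def)
  have "p < n" using assms(1) by (simp add: open_knots_def)
  hence "p + 1 \<in> S" using open_knots_boundary[OF assms(1)] assms(2) by (simp add: S_def)
  hence "Max S \<in> S" using Max_in[OF fin] by blast
  hence max: "p + 1 \<le> Max S" "Max S \<le> n" "\<xi> (Max S) \<le> x" by (auto simp: S_def)
  have "x < \<xi> (Max S + 1)"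
  proof (cases "Max S = n")
    case True
    then show ?thesis using open_knots_boundary(2)[OF assms(1)] assms(3) by simp
  next
    case False
    show ?thesis
    proof (rule ccontr)
      assume "\<not> x < \<xi> (Max S + 1)"
      hence "Max S + 1 \<in> S" using max False by (auto simp: S_def)
      hence "Max S + 1 \<le> Max S" by (rule Max_ge[OF fin])
      thus False by simp
    qed
  qed
  with max show ?thesis by (intro that[of "Max S - p"]) auto
qed

lemma bspline_sum_on_span:
  assumes "open_knots p n a b \<xi>" and "1 \<le> l" and "l + p \<le> n"
    and "\<xi> (l + p) \<le> x" and "x < \<xi> (l + p + 1)"
  shows "(\<Sum>i\<in>{1..n}. c i * bspline \<xi> p i x) = (\<Sum>t\<le>p. c (l + t) * bspline \<xi> p (l + t) x)"
proof -
  note mono_on = open_knots_mono[OF assms(1)]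
  note mono = mono_onD[OF mono_on]
  have "bspline \<xi> p i x = 0" if i: "i \<in> {1..n} - {l..l + p}" for i
  proof (rule bspline_local_support)
    show "mono_on {i..i + p + 1} \<xi>" using i by (intro mono_on_subset[OF mono_on]) auto
    show "x < \<xi> i \<or> \<xi> (i + p + 1) \<le> x"
    proof (cases "i < l")
      case True
      with i assms(2,3) have "\<xi> (i + p + 1) \<le> \<xi> (l + p)" by (intro mono) auto
      with assms(4) show ?thesis by simp
    next
      case False
      with i assms(2,3) have "\<xi> (l + p + 1) \<le> \<xi> i" by (intro mono) auto
      with assms(5) show ?thesis by simp
    qed
  qed
  hence "(\<Sum>i\<in>{1..n}. c i * bspline \<xi> p i x) = (\<Sum>i\<in>{l..l + p}. c i * bspline \<xi> p i x)"
    using assms(2,3) by (intro sum.mono_neutral_right) auto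
  also have "\<dots> = (\<Sum>t\<le>p. c (l + t) * bspline \<xi> p (l + t) x)"
    by (rule sum.reindex_bij_witness[of _ "\<lambda>t. l + t" "\<lambda>i. i - l"]) auto
  finally show ?thesis .
qed

lemma bspline_partition_of_unity:
  assumes "open_knots p n a b \<xi>" and "a \<le> x" and "x < b"
  shows "(\<Sum>i\<in>{1..n}. bspline \<xi> p i x) = 1"
proof -
  obtain l where l: "1 \<le> l" "l + p \<le> n" "\<xi> (l + p) \<le> x" "x < \<xi> (l + p + 1)"
    using open_knots_span[OF assms] .
  have "mono_on {l..l + 2 * p + 1} \<xi>"
    by (rule mono_on_subset[OF open_knots_mono[OF assms(1)]]) (use l in auto)
  hence "(\<Sum>t\<le>p. bspline \<xi> p (l + t) x) = 1"
    using l by (intro bspline_partition_of_unity_local)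
  thus ?thesis using bspline_sum_on_span[OF assms(1) l, of "\<lambda>_. 1"] by simp
qed

lemma measurable_bspline [measurable]: "bspline \<xi> p i \<in> borel_measurable borel"
proof (induction p arbitrary: i)
  case 0
  have "bspline \<xi> 0 i = indicator {\<xi> i..<\<xi> (i + 1)}" by (auto simp: fun_eq_iff indicator_def)
  then show ?case by simp
next
  case (Suc p)
  note Suc.IH[measurable]
  show ?case unfolding bspline.simps(2) by measurable
qed

lemma bounded_bspline: "\<exists>C. \<forall>x\<in>{a..b}. \<bar>bspline \<xi> p i x\<bar> \<le> C"
proof (induction p arbitrary: i)
  case 0
  show ?case by (intro exI[of _ 1]) auto
next
  case (Suc p)
  have weight: "\<exists>K. \<forall>x\<in>{a..b}. \<bar>g x\<bar> \<le> K" if "continuous_on {a..b} g" for g :: "real \<Rightarrow> real"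
    using compact_imp_bounded[OF compact_continuous_image[OF that compact_Icc]]
    by (auto simp: bounded_iff)
  obtain C1 where C1: "\<And>x. x \<in> {a..b} \<Longrightarrow> \<bar>bspline \<xi> p i x\<bar> \<le> C1" using Suc.IH[of i] by blast
  obtain C2 where C2: "\<And>x. x \<in> {a..b} \<Longrightarrow> \<bar>bspline \<xi> p (i + 1) x\<bar> \<le> C2" using Suc.IH[of "i + 1"] by blast
  obtain K1 where K1: "\<And>x. x \<in> {a..b} \<Longrightarrow> \<bar>(x - \<xi> i) * (1 / (\<xi> (i + Suc p) - \<xi> i))\<bar> \<le> K1"
    using weight[OF continuous_on_mult_right[OF continuous_on_diff[OF continuous_on_id continuous_on_const]]] by blast
  obtain K2 where K2: "\<And>x. x \<in> {a..b} \<Longrightarrow>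
      \<bar>(\<xi> (i + Suc p + 1) - x) * (1 / (\<xi> (i + Suc p + 1) - \<xi> (i + 1)))\<bar> \<le> K2"
    using weight[OF continuous_on_mult_right[OF continuous_on_diff[OF continuous_on_const continuous_on_id]]] by blast
  have "\<bar>bspline \<xi> (Suc p) i x\<bar> \<le> K1 * C1 + K2 * C2" if x: "x \<in> {a..b}" for x
  proof -
    have "bspline \<xi> (Suc p) i x = (x - \<xi> i) * (1 / (\<xi> (i + Suc p) - \<xi> i)) * bspline \<xi> p i x
        + (\<xi> (i + Suc p + 1) - x) * (1 / (\<xi> (i + Suc p + 1) - \<xi> (i + 1))) * bspline \<xi> p (i + 1) x"
      by simp
    also have "\<bar>\<dots>\<bar> \<le> K1 * C1 + K2 * C2"
      unfolding abs_mult[of _ "bspline \<xi> p i x"] abs_mult[of _ "bspline \<xi> p (i + 1) x"]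
      by (rule order_trans[OF abs_triangle_ineq add_mono];
          subst abs_mult, rule mult_mono') (use C1[OF x] C2[OF x] K1[OF x] K2[OF x] in auto)
    finally show ?thesis .
  qed
  thus ?case by blast
qed

lemma AE_uni_measure_iff:
  assumes "f \<in> borel_measurable borel" and "\<And>x. 0 \<le> f x"
  shows "(AE x in uni_measure a b f. P x) \<longleftrightarrow> (AE x in lborel. x \<in> {a..b} \<longrightarrow> f x \<noteq> 0 \<longrightarrow> P x)"
proof -
  have "(\<lambda>x. ennreal (f x)) \<in> borel_measurable (restrict_space lborel {a..b})"
    using assms(1) by (intro measurable_restrict_space1) simp
  hence "(AE x in uni_measure a b f. P x) \<longleftrightarrow> (AE x in restrict_space lborel {a..b}. 0 < f x \<longrightarrow> P x)"
    unfolding uni_measure_def by (simp add: AE_density)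
  also have "\<dots> \<longleftrightarrow> (AE x in lborel. x \<in> {a..b} \<longrightarrow> 0 < f x \<longrightarrow> P x)"
    by (simp add: AE_restrict_space_iff)
  finally show ?thesis using assms(2) by (simp add: less_le)
qed

text \<open>
  Given \<open>i\<close>, a nonempty knot interval inside the support of \<open>B\<^sub>i\<close> contains an open set \<open>J\<close> on which
  the density is positive. A nonempty open set is not a null set, so the continuous combination
  vanishes throughout \<open>J\<close>, and local independence applies.
\<close>

lemma bspline_ae_independent:
  assumes knots: "open_knots p n a b \<xi>"
    and "f \<in> borel_measurable borel" and "\<And>x. 0 \<le> f x"
    and cont: "continuous_on {a..b} f" and supp: "closure {x. f x \<noteq> 0} = {a..b}"
    and ae: "AE x in uni_measure a b f. (\<Sum>i\<in>{1..n}. c i * bspline \<xi> p i x) = 0"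
    and i: "i \<in> {1..n}"
  shows "c i = 0"
proof -
  note mono_on = open_knots_mono[OF knots]
  note mono = mono_onD[OF mono_on]
  have k: "\<xi> 1 = a" "\<xi> (n + p + 1) = b" using knots by (auto simp: open_knots_def)
  have less: "\<xi> i < \<xi> (i + p + 1)" using knots i by (rule open_knots_support_nonempty)
  have "\<xi> 1 \<le> \<xi> i" "\<xi> (i + p + 1) \<le> \<xi> (n + p + 1)" using i by (auto intro!: mono)
  then obtain l where l: "1 \<le> l" "l + p \<le> n" "\<xi> (l + p) \<le> \<xi> i" "\<xi> i < \<xi> (l + p + 1)"
    using open_knots_span[OF knots, of "\<xi> i"] less k by auto
  have "i \<le> l + p"
  proof (rule ccontr)
    assume "\<not> i \<le> l + p"
    with i have "\<xi> (l + p + 1) \<le> \<xi> i" by (intro mono) auto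
    with l show False by simp
  qed
  moreover have "l \<le> i"
  proof (rule ccontr)
    assume "\<not> l \<le> i"
    with i l have "\<xi> (i + p + 1) \<le> \<xi> (l + p)" by (intro mono) auto
    with l less show False by simp
  qed
  ultimately obtain t where t: "i = l + t" "t \<le> p" by (metis add_le_cancel_left le_Suc_ex)
  have ml: "mono_on {l..l + 2 * p + 1} \<xi>"
    by (rule mono_on_subset[OF mono_on]) (use l in auto)
  define W where "W = {\<xi> (l + p)<..<\<xi> (l + p + 1)}"
  have "\<xi> 1 \<le> \<xi> (l + p)" "\<xi> (l + p + 1) \<le> \<xi> (n + p + 1)" using l by (auto intro!: mono)
  hence W: "W \<subseteq> {a..b}" using k by (auto simp: W_def)
  have openW: "open W" by (simp add: W_def)
  define J where "J = W \<inter> f -` (- {0})"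
  have openJ: "open J"
    unfolding J_def by (rule continuous_open_preimage[OF continuous_on_subset[OF cont W] openW]) auto
  have "W \<noteq> {}" using l by (simp add: W_def)
  hence "W \<inter> closure {x. f x \<noteq> 0} \<noteq> {}" using W supp by auto
  hence "W \<inter> {x. f x \<noteq> 0} \<noteq> {}" using open_Int_closure_eq_empty[OF openW] by blast
  hence J: "J \<noteq> {}" by (auto simp: J_def)
  define g where "g x = (\<Sum>t\<le>p. c (l + t) * bspline \<xi> p (l + t) x)" for x
  have "isCont (bspline \<xi> p (l + t)) x" if x: "x \<in> J" and t: "t \<le> p" for x t
  proof -
    have x': "\<xi> (l + p) < x" "x < \<xi> (l + p + 1)" using x by (auto simp: J_def W_def)
    have nk: "\<xi> j \<noteq> x" if "j \<in> {l..l + 2 * p + 1}" for j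
      using x' mono_onD[OF ml, of j "l + p"] mono_onD[OF ml, of "l + p + 1" j] that
      by (cases "j \<le> l + p") auto
    show ?thesis
    proof (cases p)
      case 0
      \<comment> \<open>Not covered by the derivative formula: in degree 0 the B-spline is constant on the interval.\<close>
      have "isCont (indicator {\<xi> l..<\<xi> (l + 1)} :: real \<Rightarrow> real) x"
        using x' 0 by (intro continuous_on_interior[of "{\<xi> l<..<\<xi> (l + 1)}"]
          continuous_on_cong[THEN iffD1, OF refl _ continuous_on_const[of _ 1]]) (auto simp: interior_open)
      moreover have "bspline \<xi> 0 l = indicator {\<xi> l..<\<xi> (l + 1)}" by (auto simp: fun_eq_iff indicator_def)
      ultimately show ?thesis using 0 t by simp
    next
      case (Suc q)
      have "mono_on {l + t..l + t + q + 2} \<xi>"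
        by (rule mono_on_subset[OF ml]) (use t Suc in auto)
      moreover have "\<xi> j \<noteq> x" if "j \<in> {l + t..l + t + q + 2}" for j
        by (rule nk) (use that t Suc in auto)
      ultimately show ?thesis unfolding Suc by (rule DERIV_isCont[OF bspline_has_derivative])
    qed
  qed
  hence "continuous_on J g"
    unfolding g_def by (intro continuous_at_imp_continuous_on ballI continuous_intros) auto
  hence "open (J \<inter> g -` (- {0}))" by (rule continuous_open_preimage[OF _ openJ]) auto
  moreover have "negligible (J \<inter> g -` (- {0}))"
  proof -
    have "AE x in lborel. x \<in> {a..b} \<longrightarrow> f x \<noteq> 0 \<longrightarrow> (\<Sum>i\<in>{1..n}. c i * bspline \<xi> p i x) = 0"
      using ae unfolding AE_uni_measure_iff[OF assms(2,3)] .
    hence "AE x in lborel. x \<notin> J \<inter> g -` (- {0})"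
    proof eventually_elim
      case (elim x)
      show ?case
      proof
        assume x: "x \<in> J \<inter> g -` (- {0})"
        hence "x \<in> W" "f x \<noteq> 0" by (auto simp: J_def)
        hence "(\<Sum>i\<in>{1..n}. c i * bspline \<xi> p i x) = g x"
          unfolding g_def using l by (intro bspline_sum_on_span[OF knots]) (auto simp: W_def)
        with elim \<open>x \<in> W\<close> \<open>f x \<noteq> 0\<close> W x show False by auto
      qed
    qed
    hence "J \<inter> g -` (- {0}) \<in> null_sets lborel"
      using calculation by (subst AE_iff_null_sets) auto
    thus ?thesis unfolding negligible_iff_null_sets by (rule null_sets_completionI)
  qed
  ultimately have "J \<inter> g -` (- {0}) = {}" using open_not_negligible by blast
  hence "g x = 0" if "x \<in> J" for x using that by auto
  thus ?thesis
    using bspline_locally_independent[OF ml openJ J _ _ t(2), of "\<lambda>t. c (l + t)"]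
    by (auto simp: J_def W_def g_def t(1))
qed

section \<open>Existence of the Cholesky factor\<close>

lemma forward_substitution:
  fixes q :: "nat \<Rightarrow> nat \<Rightarrow> real"
  assumes "\<And>i. i < n \<Longrightarrow> q i i \<noteq> 0" and "\<And>i j. i < j \<Longrightarrow> q i j = 0"
  shows "\<exists>w. \<forall>i<n. (\<Sum>k<n. q i k * w k) = v i"
  using assms(1)
proof (induction n)
  case (Suc n)
  then obtain w where w: "\<forall>i<n. (\<Sum>k<n. q i k * w k) = v i" by fastforce
  define w' where "w' = w(n := (v n - (\<Sum>k<n. q n k * w k)) / q n n)"
  have "(\<Sum>k<n. q i k * w' k) = (\<Sum>k<n. q i k * w k)" for i
    by (intro sum.cong) (auto simp: w'_def)
  hence "\<forall>i<Suc n. (\<Sum>k<Suc n. q i k * w' k) = v i"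
    using w Suc.prems[of n] assms(2) by (auto simp: w'_def less_Suc_eq)
  then show ?case by blast
qed auto

lemma backward_substitution:
  fixes q :: "nat \<Rightarrow> nat \<Rightarrow> real"
  assumes "\<And>i. i < n \<Longrightarrow> q i i \<noteq> 0" and "\<And>i j. i < j \<Longrightarrow> q i j = 0"
  shows "\<exists>z. \<forall>k<n. (\<Sum>i<n. q i k * z i) = v k"
  using assms(1)
proof (induction n arbitrary: v)
  case (Suc n)
  define y where "y = v n / q n n"
  obtain z where z: "\<forall>k<n. (\<Sum>i<n. q i k * z i) = v k - q n k * y"
    using Suc.IH[of "\<lambda>k. v k - q n k * y"] Suc.prems by fastforce
  define z' where "z' = z(n := y)"
  have "(\<Sum>i<n. q i k * z' i) = (\<Sum>i<n. q i k * z i)" for k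
    by (intro sum.cong) (auto simp: z'_def)
  moreover have "(\<Sum>i<n. q i n * z i) = 0"
    by (intro sum.neutral) (auto simp: assms(2))
  ultimately have "\<forall>k<Suc n. (\<Sum>i<Suc n. q i k * z' i) = v k"
    using z Suc.prems[of n] by (auto simp: z'_def y_def less_Suc_eq)
  then show ?case by blast
qed auto

text \<open>
  Induction over the order. The new last row \<open>(w, s)\<close> of the factor must satisfy \<open>q w = v\<close>, where \<open>v\<close> is
  the new column of \<open>g\<close> without its corner \<open>d\<close>, and \<open>s\<^sup>2 = d - |w|\<^sup>2\<close>. The right-hand side is positive because it is
  the value of the quadratic form at \<open>(z, 1)\<close> with \<open>q\<^sup>T z = - w\<close>.
\<close>

lemma cholesky_factors_exist:
  fixes g :: "nat \<Rightarrow> nat \<Rightarrow> real"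
  assumes "\<And>i j. i < n \<Longrightarrow> j < n \<Longrightarrow> g i j = g j i"
    and "\<And>z. \<exists>i<n. z i \<noteq> 0 \<Longrightarrow> 0 < (\<Sum>i<n. \<Sum>j<n. z i * g i j * z j)"
  shows "\<exists>q. (\<forall>i<n. 0 < q i i) \<and> (\<forall>i j. i < j \<longrightarrow> q i j = 0) \<and>
             (\<forall>i<n. \<forall>j<n. g i j = (\<Sum>k<n. q i k * q j k))"
  using assms
proof (induction n)
  case 0
  show ?case by (rule exI[of _ "\<lambda>_ _. 0"]) auto
next
  case (Suc n)
  have "0 < (\<Sum>i<n. \<Sum>j<n. z i * g i j * z j)" if "\<exists>i<n. z i \<noteq> 0" for z
  proof -
    define y where "y = z(n := 0)"
    have "0 < (\<Sum>i<Suc n. \<Sum>j<Suc n. y i * g i j * y j)"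
      using that by (intro Suc.prems(2)) (auto simp: y_def intro: less_SucI)
    also have "\<dots> = (\<Sum>i<n. \<Sum>j<n. y i * g i j * y j)" by (simp add: y_def)
    also have "\<dots> = (\<Sum>i<n. \<Sum>j<n. z i * g i j * z j)"
      by (intro sum.cong refl) (auto simp: y_def)
    finally show ?thesis .
  qed
  with Suc.prems(1) have "\<exists>q. (\<forall>i<n. 0 < q i i) \<and> (\<forall>i j. i < j \<longrightarrow> q i j = 0) \<and>
      (\<forall>i<n. \<forall>j<n. g i j = (\<Sum>k<n. q i k * q j k))"
    by (intro Suc.IH) auto
  then obtain q where "(\<forall>i<n. 0 < q i i) \<and> (\<forall>i j. i < j \<longrightarrow> q i j = 0) \<and>
      (\<forall>i<n. \<forall>j<n. g i j = (\<Sum>k<n. q i k * q j k))"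
    by (elim exE)
  hence q: "\<And>i. i < n \<Longrightarrow> 0 < q i i" "\<And>i j. i < j \<Longrightarrow> q i j = 0"
      "\<And>i j. i < n \<Longrightarrow> j < n \<Longrightarrow> g i j = (\<Sum>k<n. q i k * q j k)"
    by auto
  have q0: "q i i \<noteq> 0" if "i < n" for i using q(1)[OF that] by simp
  obtain w where w: "\<And>i. i < n \<Longrightarrow> (\<Sum>k<n. q i k * w k) = g i n"
    using forward_substitution[of n q "\<lambda>i. g i n"] q0 q(2) by blast
  obtain z where z: "\<And>k. k < n \<Longrightarrow> (\<Sum>i<n. q i k * z i) = - w k"
    using backward_substitution[of n q "\<lambda>k. - w k"] q0 q(2) by blast
  define W where "W = (\<Sum>k<n. (w k)\<^sup>2)"
  have mixed: "(\<Sum>i<n. z i * g i n) = - W"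
  proof -
    have "(\<Sum>i<n. z i * g i n) = (\<Sum>i<n. \<Sum>k<n. z i * (q i k * w k))"
      by (intro sum.cong refl) (simp add: w[symmetric] sum_distrib_left)
    also have "\<dots> = (\<Sum>k<n. \<Sum>i<n. z i * (q i k * w k))" by (rule sum.swap)
    also have "\<dots> = (\<Sum>k<n. (\<Sum>i<n. q i k * z i) * w k)"
      by (simp add: sum_distrib_left sum_distrib_right ac_simps)
    also have "\<dots> = - W" by (simp add: z W_def sum_negf power2_eq_square)
    finally show ?thesis .
  qed
  have quad: "(\<Sum>i<n. \<Sum>j<n. z i * g i j * z j) = W"
  proof -
    have "(\<Sum>i<n. \<Sum>j<n. z i * g i j * z j) = (\<Sum>i<n. \<Sum>j<n. \<Sum>k<n. (q i k * z i) * (q j k * z j))"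
      by (intro sum.cong refl) (simp add: q(3) sum_distrib_left sum_distrib_right ac_simps)
    also have "\<dots> = (\<Sum>i<n. \<Sum>k<n. \<Sum>j<n. (q i k * z i) * (q j k * z j))"
      by (intro sum.cong refl sum.swap)
    also have "\<dots> = (\<Sum>k<n. \<Sum>i<n. \<Sum>j<n. (q i k * z i) * (q j k * z j))" by (rule sum.swap)
    also have "\<dots> = (\<Sum>k<n. (\<Sum>i<n. q i k * z i)\<^sup>2)" by (simp add: power2_eq_square sum_product)
    also have "\<dots> = W" by (simp add: z W_def)
    finally show ?thesis .
  qed
  \<comment> \<open>The last entry 1 makes the quadratic form equal to \<open>W - 2 * W + g n n\<close>.\<close>
  define y where "y = z(n := 1)"
  have "0 < (\<Sum>i<Suc n. \<Sum>j<Suc n. y i * g i j * y j)"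
    by (intro Suc.prems(2)) (auto simp: y_def)
  also have "\<dots> = (\<Sum>i<n. \<Sum>j<n. y i * g i j * y j) + (\<Sum>i<n. y i * g i n) + (\<Sum>i<n. g n i * y i) + g n n"
    by (simp add: sum.distrib) (simp add: y_def)
  also have "(\<Sum>i<n. g n i * y i) = (\<Sum>i<n. z i * g i n)"
    by (intro sum.cong refl) (auto simp: y_def Suc.prems(1))
  also have "(\<Sum>i<n. y i * g i n) = (\<Sum>i<n. z i * g i n)"
    by (intro sum.cong refl) (auto simp: y_def)
  also have "(\<Sum>i<n. \<Sum>j<n. y i * g i j * y j) = (\<Sum>i<n. \<Sum>j<n. z i * g i j * z j)"
    by (intro sum.cong refl) (auto simp: y_def)
  finally have pos: "0 < g n n - W" by (simp add: mixed quad)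
  define q' where "q' i j = (if i = n then (if j < n then w j else if j = n then sqrt (g n n - W) else 0)
      else if j < n then q i j else 0)" for i j
  have col: "(\<Sum>k<Suc n. q' i k * q' j k) = (\<Sum>k<n. q i k * q j k)" if "i < n" "j < n" for i j
    using that by (simp add: q'_def)
  have mix: "(\<Sum>k<Suc n. q' i k * q' n k) = g i n" if "i < n" for i
    using that w[OF that] by (simp add: q'_def)
  have corner: "(\<Sum>k<Suc n. q' n k * q' n k) = g n n"
    using pos by (simp add: q'_def W_def power2_eq_square)
  have "g i j = (\<Sum>k<Suc n. q' i k * q' j k)" if ij: "i < Suc n" "j < Suc n" for i j
  proof (cases "i < n"; cases "j < n")
    assume "i < n" "j < n"
    thus ?thesis using col q(3) by simp
  next
    assume *: "i < n" "\<not> j < n"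
    hence "j = n" using ij by simp
    thus ?thesis using mix[OF *(1)] by simp
  next
    assume *: "\<not> i < n" "j < n"
    hence "i = n" using ij by simp
    hence "g i j = (\<Sum>k<Suc n. q' j k * q' n k)" using mix[OF *(2)] Suc.prems(1)[of n j] * by simp
    thus ?thesis using \<open>i = n\<close> by (simp add: mult.commute)
  next
    assume "\<not> i < n" "\<not> j < n"
    hence "i = n" "j = n" using ij by auto
    thus ?thesis using corner by simp
  qed
  moreover have "\<forall>i<Suc n. 0 < q' i i" using q(1) pos by (auto simp: q'_def less_Suc_eq)
  moreover have "\<forall>i j. i < j \<longrightarrow> q' i j = 0" using q(2) by (auto simp: q'_def)
  ultimately show ?case by blast
qed

lemma is_cholesky_cholesky:
  assumes "G \<in> carrier_mat n n"
    and "\<And>i j. i < n \<Longrightarrow> j < n \<Longrightarrow> G $$ (i, j) = G $$ (j, i)"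
    and "\<And>z. \<exists>i<n. z i \<noteq> 0 \<Longrightarrow> 0 < (\<Sum>i<n. \<Sum>j<n. z i * G $$ (i, j) * z j)"
  shows "is_cholesky G (cholesky G)"
proof -
  have "\<exists>q. (\<forall>i<n. 0 < q i i) \<and> (\<forall>i j. i < j \<longrightarrow> q i j = 0) \<and>
      (\<forall>i<n. \<forall>j<n. G $$ (i, j) = (\<Sum>k<n. q i k * q j k))"
    using assms(2,3) by (rule cholesky_factors_exist)
  then obtain q where q: "(\<forall>i<n. 0 < q i i) \<and> (\<forall>i j. i < j \<longrightarrow> q i j = 0) \<and>
      (\<forall>i<n. \<forall>j<n. G $$ (i, j) = (\<Sum>k<n. q i k * q j k))"
    by (elim exE)
  have "is_cholesky G (mat n n (\<lambda>(i, j). q i j))"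
    using assms(1) q unfolding is_cholesky_def
    by (auto intro!: eq_matI simp: scalar_prod_def lessThan_atLeast0)
  thus ?thesis unfolding cholesky_def by (rule someI)
qed

text \<open>
  The identity \<open>R G R\<^sup>T = 1\<close> is the orthonormality of the functions \<open>\<psi>\<close>. The last claim makes the first of
  them the constant 1: the factor is lower triangular with the corner \<open>sqrt (G\<^sub>0\<^sub>0) = 1\<close>, so the first row of
  its inverse is a unit vector.
\<close>

lemma inverse_cholesky_factor:
  assumes "is_cholesky G Q" and "G \<in> carrier_mat n n"
  defines "R \<equiv> the (mat_inverse Q)"
  shows "R \<in> carrier_mat n n" and "R * Q = 1\<^sub>m n" and "Q * R = 1\<^sub>m n"
    and "R * G * transpose_mat R = 1\<^sub>m n"
    and "0 < n \<Longrightarrow> G $$ (0, 0) = 1 \<Longrightarrow> row R 0 = unit_vec n 0"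
proof -
  have Q: "Q \<in> carrier_mat n n" and low: "\<And>i j. i < j \<Longrightarrow> j < n \<Longrightarrow> Q $$ (i, j) = 0"
    and diag: "\<And>i. i < n \<Longrightarrow> 0 < Q $$ (i, i)" and G: "G = Q * transpose_mat Q"
    using assms(1,2) by (auto simp: is_cholesky_def)
  have "det Q = prod_list (diag_mat Q)" by (rule det_lower_triangular[OF low Q])
  also have "\<dots> \<noteq> 0" using diag Q by (force simp: prod_list_zero_iff diag_mat_def)
  finally have "mat_inverse Q \<noteq> None" using mat_inverse(1)[OF Q, where b = "()"] det_non_zero_imp_unit[OF Q, where b = "()"] by blast
  then obtain B where B: "mat_inverse Q = Some B" by auto
  show R: "R \<in> carrier_mat n n" and RQ: "R * Q = 1\<^sub>m n" and QR: "Q * R = 1\<^sub>m n"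
    using mat_inverse(2)[OF Q B] B by (auto simp: R_def)
  have "R * G * transpose_mat R = (R * Q) * (transpose_mat Q * transpose_mat R)"
    unfolding G using Q R by (simp add: assoc_mult_mat[of _ n n _ n _ n])
  also have "transpose_mat Q * transpose_mat R = transpose_mat (R * Q)"
    by (rule transpose_mult[OF R Q, symmetric])
  finally show "R * G * transpose_mat R = 1\<^sub>m n" by (simp add: RQ)
  assume n: "0 < n" and G0: "G $$ (0, 0) = 1"
  have first: "Q $$ (0, k) = 0" if "0 < k" "k < n" for k using low that by blast
  have *: "(\<Sum>k = 0..<n. Q $$ (0, k) * h k) = Q $$ (0, 0) * h 0" for h :: "nat \<Rightarrow> real"
    using n first by (subst sum.remove[of _ 0]) auto
  have "1 = (\<Sum>k = 0..<n. Q $$ (0, k) * Q $$ (0, k))"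
    using G0 n Q by (simp add: G scalar_prod_def)
  hence "(Q $$ (0, 0))\<^sup>2 = 1" by (simp only: * power2_eq_square)
  hence Q0: "Q $$ (0, 0) = 1" using diag[OF n] by (simp add: power2_eq_1_iff)
  have "R $$ (0, j) = (if j = 0 then 1 else 0)" if "j < n" for j
  proof -
    have "(Q * R) $$ (0, j) = (\<Sum>k = 0..<n. Q $$ (0, k) * R $$ (k, j))"
      using n Q R that by (simp add: scalar_prod_def)
    thus ?thesis using n that by (simp only: * Q0 QR) simp
  qed
  thus "row R 0 = unit_vec n 0" using R n by (intro eq_vecI) auto
qed

section \<open>Spans modulo null sets\<close>

text \<open>
  Coefficients are indexed by \<open>I\<close> instead of by functions. Since \<open>e\<close> need not be injective, one
  direction chooses representatives and the other adds up the coefficients over fibres.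
\<close>

lemma ae_span_image_iff:
  assumes "finite I"
  shows "g \<in> ae_span \<mu> (e ` I) \<longleftrightarrow>
    g \<in> borel_measurable \<mu> \<and> (\<exists>c. AE x in \<mu>. g x = (\<Sum>i\<in>I. c i * e i x))"
proof
  assume "g \<in> ae_span \<mu> (e ` I)"
  then obtain T c where g: "g \<in> borel_measurable \<mu>" and T: "T \<subseteq> e ` I"
    and ae: "AE x in \<mu>. g x = (\<Sum>h\<in>T. c h * h x)"
    unfolding ae_span_def by auto
  obtain U where U: "U \<subseteq> I" "inj_on e U" "T = e ` U"
    using T by (auto simp: subset_image_inj)
  have "(\<Sum>h\<in>T. c h * h x) = (\<Sum>i\<in>I. (if i \<in> U then c (e i) else 0) * e i x)" for x
  proof -
    have "(\<Sum>h\<in>T. c h * h x) = (\<Sum>i\<in>U. c (e i) * e i x)"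
      using U by (simp add: sum.reindex)
    also have "\<dots> = (\<Sum>i\<in>I. (if i \<in> U then c (e i) else 0) * e i x)"
      using U assms by (intro sum.mono_neutral_cong_left) auto
    finally show ?thesis .
  qed
  with ae have "AE x in \<mu>. g x = (\<Sum>i\<in>I. (if i \<in> U then c (e i) else 0) * e i x)" by simp
  with g show "g \<in> borel_measurable \<mu> \<and> (\<exists>c. AE x in \<mu>. g x = (\<Sum>i\<in>I. c i * e i x))"
    by (intro conjI exI)
next
  assume "g \<in> borel_measurable \<mu> \<and> (\<exists>c. AE x in \<mu>. g x = (\<Sum>i\<in>I. c i * e i x))"
  then obtain c where g: "g \<in> borel_measurable \<mu>" and ae: "AE x in \<mu>. g x = (\<Sum>i\<in>I. c i * e i x)"
    by auto
  have "(\<Sum>i\<in>I. c i * e i x) = (\<Sum>h\<in>e ` I. (\<Sum>i\<in>{i \<in> I. e i = h}. c i) * h x)" for x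
    unfolding sum.image_gen[OF assms, of "\<lambda>i. c i * e i x" e] sum_distrib_right
    by (intro sum.cong refl) auto
  with ae have "AE x in \<mu>. g x = (\<Sum>h\<in>e ` I. (\<Sum>i\<in>{i \<in> I. e i = h}. c i) * h x)" by simp
  with g assms show "g \<in> ae_span \<mu> (e ` I)" unfolding ae_span_def
    by (intro CollectI conjI exI[of _ "e ` I"] exI[of _ "\<lambda>h. \<Sum>i\<in>{i \<in> I. e i = h}. c i"]) auto
qed

lemma ae_span_generator:
  assumes "h \<in> F" and "h \<in> borel_measurable \<mu>"
  shows "h \<in> ae_span \<mu> F"
  unfolding ae_span_def using assms
  by (intro CollectI conjI exI[of _ "{h}"] exI[of _ "\<lambda>_. 1"]) auto

lemma ae_span_mono: "F \<subseteq> F' \<Longrightarrow> ae_span \<mu> F \<subseteq> ae_span \<mu> F'"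
  unfolding ae_span_def by (intro Collect_mono) (meson subset_trans)

lemma ae_span_minimal:
  assumes "finite F'" and "F \<subseteq> ae_span \<mu> F'"
  shows "ae_span \<mu> F \<subseteq> ae_span \<mu> F'"
proof
  note iff = ae_span_image_iff[OF assms(1), of _ \<mu> "\<lambda>h. h", unfolded image_ident]
  fix g assume "g \<in> ae_span \<mu> F"
  then obtain T c where g: "g \<in> borel_measurable \<mu>" and T: "finite T" "T \<subseteq> F"
    and ae: "AE x in \<mu>. g x = (\<Sum>h\<in>T. c h * h x)"
    unfolding ae_span_def by auto
  have "\<forall>h\<in>T. \<exists>d. AE x in \<mu>. h x = (\<Sum>h'\<in>F'. d h' * h' x)"
    using T(2) assms(2) iff by blast
  then obtain d where "\<forall>h\<in>T. AE x in \<mu>. h x = (\<Sum>h'\<in>F'. d h h' * h' x)"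
    by (auto dest: bchoice)
  hence "AE x in \<mu>. \<forall>h\<in>T. h x = (\<Sum>h'\<in>F'. d h h' * h' x)"
    using T(1) by (simp add: AE_finite_all)
  with ae have "AE x in \<mu>. g x = (\<Sum>h'\<in>F'. (\<Sum>h\<in>T. c h * d h h') * h' x)"
  proof eventually_elim
    case (elim x)
    have "g x = (\<Sum>h\<in>T. c h * (\<Sum>h'\<in>F'. d h h' * h' x))"
      unfolding elim(1) using elim(2) by (intro sum.cong refl) auto
    also have "\<dots> = (\<Sum>h\<in>T. \<Sum>h'\<in>F'. c h * d h h' * h' x)"
      by (simp add: sum_distrib_left mult.assoc)
    also have "\<dots> = (\<Sum>h'\<in>F'. \<Sum>h\<in>T. c h * d h h' * h' x)" by (rule sum.swap)
    finally show ?case by (simp add: sum_distrib_right)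
  qed
  hence "\<exists>c. AE x in \<mu>. g x = (\<Sum>h'\<in>F'. c h' * h' x)"
    by (intro exI[of _ "\<lambda>h'. \<Sum>h\<in>T. c h * d h h'"])
  with g show "g \<in> ae_span \<mu> F'" using iff by blast
qed

text \<open>
  Integrating a vanishing combination against \<open>e j\<close> extracts the coefficient of \<open>e j\<close>.
\<close>

lemma orthonormal_ae_basis:
  assumes "finite I"
    and "\<And>i j. i \<in> I \<Longrightarrow> j \<in> I \<Longrightarrow> integrable \<mu> (\<lambda>x. e i x * e j x)"
    and "\<And>i j. i \<in> I \<Longrightarrow> j \<in> I \<Longrightarrow> (\<integral>x. e i x * e j x \<partial>\<mu>) = (if i = j then 1 else 0)"
  shows "ae_basis \<mu> I e (ae_span \<mu> (e ` I))"
  unfolding ae_basis_def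
proof (intro conjI allI impI ballI refl assms(1))
  fix c j assume ae: "AE x in \<mu>. (\<Sum>i\<in>I. c i * e i x) = 0" and j: "j \<in> I"
  have "0 = (\<integral>x. 0 \<partial>\<mu>)" by simp
  also have "\<dots> = (\<integral>x. (\<Sum>i\<in>I. c i * (e i x * e j x)) \<partial>\<mu>)"
  proof (rule integral_cong_AE)
    show "(\<lambda>x. \<Sum>i\<in>I. c i * (e i x * e j x)) \<in> borel_measurable \<mu>"
      using assms(2) j by (intro borel_measurable_sum borel_measurable_times borel_measurable_const
          borel_measurable_integrable) auto
    show "AE x in \<mu>. 0 = (\<Sum>i\<in>I. c i * (e i x * e j x))"
      using ae
    proof eventually_elim
      case (elim x)
      have "(\<Sum>i\<in>I. c i * (e i x * e j x)) = (\<Sum>i\<in>I. c i * e i x) * e j x"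
        by (simp add: sum_distrib_right mult.assoc)
      with elim show ?case by simp
    qed
  qed simp
  also have "\<dots> = (\<Sum>i\<in>I. c i * (\<integral>x. e i x * e j x \<partial>\<mu>))"
    using assms(2) j by (subst Bochner_Integration.integral_sum) auto
  also have "\<dots> = (\<Sum>i\<in>I. if i = j then c i else 0)"
    using assms(3) j by (intro sum.cong refl) auto
  also have "\<dots> = c j" using assms(1) j by simp
  finally show "c j = 0" by simp
qed

text \<open>
  Inner products of members of two blocks are bilinear in the coefficients, so orthogonality needs
  to be checked on generators only; a combination of all generators is split by
  grouping its terms by block.
\<close>

lemma orthogonal_blocks_orthogonal_sum:
  assumes "finite U" and "\<And>u. u \<in> U \<Longrightarrow> finite (I u)"
    and meas: "\<And>u i. u \<in> U \<Longrightarrow> i \<in> I u \<Longrightarrow> e u i \<in> borel_measurable \<mu>"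
    and int: "\<And>u v i j. u \<in> U \<Longrightarrow> v \<in> U \<Longrightarrow> i \<in> I u \<Longrightarrow> j \<in> I v \<Longrightarrow>
      integrable \<mu> (\<lambda>x. e u i x * e v j x)"
    and orth: "\<And>u v i j. u \<in> U \<Longrightarrow> v \<in> U \<Longrightarrow> u \<noteq> v \<Longrightarrow> i \<in> I u \<Longrightarrow> j \<in> I v \<Longrightarrow>
      (\<integral>x. e u i x * e v j x \<partial>\<mu>) = 0"
  shows "is_orthogonal_sum \<mu> U (\<lambda>u. ae_span \<mu> (e u ` I u)) (ae_span \<mu> (\<Union>u\<in>U. e u ` I u))"
proof -
  note iff = ae_span_image_iff[OF assms(2)]
  have product: "integrable \<mu> (\<lambda>x. g x * h x) \<and> L2_inner \<mu> g h =
      (\<Sum>i\<in>I u. \<Sum>j\<in>I v. c i * d j * (\<integral>x. e u i x * e v j x \<partial>\<mu>))"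
    if uv: "u \<in> U" "v \<in> U" and gh: "g \<in> borel_measurable \<mu>" "h \<in> borel_measurable \<mu>"
      and ae: "AE x in \<mu>. g x = (\<Sum>i\<in>I u. c i * e u i x)" "AE x in \<mu>. h x = (\<Sum>i\<in>I v. d i * e v i x)"
    for u v g h c d
  proof -
    let ?F = "\<lambda>x. \<Sum>i\<in>I u. \<Sum>j\<in>I v. c i * d j * (e u i x * e v j x)"
    have F: "integrable \<mu> ?F" using uv int by auto
    have eq: "AE x in \<mu>. g x * h x = ?F x"
      using ae by eventually_elim (simp add: sum_product ac_simps)
    have "integrable \<mu> (\<lambda>x. g x * h x) \<longleftrightarrow> integrable \<mu> ?F"
      using gh eq borel_measurable_integrable[OF F] by (intro integrable_cong_AE) auto
    moreover have "L2_inner \<mu> g h = (\<integral>x. ?F x \<partial>\<mu>)"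
      unfolding L2_inner_def using gh eq borel_measurable_integrable[OF F] by (intro integral_cong_AE) auto
    moreover have "(\<integral>x. ?F x \<partial>\<mu>) = (\<Sum>i\<in>I u. \<Sum>j\<in>I v. c i * d j * (\<integral>x. e u i x * e v j x \<partial>\<mu>))"
      using uv int by (simp add: Bochner_Integration.integral_sum)
    ultimately show ?thesis using F by simp
  qed
  show ?thesis unfolding is_orthogonal_sum_def
  proof (intro conjI ballI impI subsetI)
    fix u g assume u: "u \<in> U" and g: "g \<in> ae_span \<mu> (e u ` I u)"
    then obtain c where "g \<in> borel_measurable \<mu>" "AE x in \<mu>. g x = (\<Sum>i\<in>I u. c i * e u i x)"
      unfolding iff[OF u] by auto
    with product[OF u u] show "g \<in> L2 \<mu>" by (simp add: L2_def power2_eq_square)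
  next
    fix u v g h assume uv: "u \<in> U" "v \<in> U" "u \<noteq> v"
      and g: "g \<in> ae_span \<mu> (e u ` I u)" and h: "h \<in> ae_span \<mu> (e v ` I v)"
    obtain c where c: "g \<in> borel_measurable \<mu>" "AE x in \<mu>. g x = (\<Sum>i\<in>I u. c i * e u i x)"
      using g unfolding iff[OF uv(1)] by auto
    obtain d where d: "h \<in> borel_measurable \<mu>" "AE x in \<mu>. h x = (\<Sum>i\<in>I v. d i * e v i x)"
      using h unfolding iff[OF uv(2)] by auto
    show "L2_inner \<mu> g h = 0"
      using product[OF uv(1,2) c(1) d(1) c(2) d(2)] uv orth by simp
  next
    have fin: "finite (Sigma U I)" using assms(1,2) by auto
    have un: "(\<Union>u\<in>U. e u ` I u) = (\<lambda>(u, i). e u i) ` Sigma U I" by auto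
    have sig: "(\<Sum>s\<in>Sigma U I. c s * (\<lambda>(u, i). e u i) s x) = (\<Sum>u\<in>U. \<Sum>i\<in>I u. c (u, i) * e u i x)" for c x
      using assms(1,2) by (subst sum.Sigma) (auto intro!: sum.cong)
    show "ae_span \<mu> (\<Union>u\<in>U. e u ` I u) = {g \<in> borel_measurable \<mu>.
        \<exists>h. (\<forall>u\<in>U. h u \<in> ae_span \<mu> (e u ` I u)) \<and> (AE x in \<mu>. g x = (\<Sum>u\<in>U. h u x))}"
      unfolding un
    proof (intro subset_antisym subsetI CollectI)
      fix g assume "g \<in> ae_span \<mu> ((\<lambda>(u, i). e u i) ` Sigma U I)"
      then obtain c where g: "g \<in> borel_measurable \<mu>"
        and c: "AE x in \<mu>. g x = (\<Sum>u\<in>U. \<Sum>i\<in>I u. c (u, i) * e u i x)"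
        unfolding ae_span_image_iff[OF fin] sig by auto
      have "(\<lambda>x. \<Sum>i\<in>I u. c (u, i) * e u i x) \<in> ae_span \<mu> (e u ` I u)" if "u \<in> U" for u
        unfolding iff[OF that] using meas[OF that]
        by (intro conjI exI[of _ "\<lambda>i. c (u, i)"]) auto
      with g c show "g \<in> borel_measurable \<mu> \<and>
          (\<exists>h. (\<forall>u\<in>U. h u \<in> ae_span \<mu> (e u ` I u)) \<and> (AE x in \<mu>. g x = (\<Sum>u\<in>U. h u x)))"
        by (intro conjI exI[of _ "\<lambda>u x. \<Sum>i\<in>I u. c (u, i) * e u i x"]) auto
    next
      fix g assume "g \<in> {g \<in> borel_measurable \<mu>.
          \<exists>h. (\<forall>u\<in>U. h u \<in> ae_span \<mu> (e u ` I u)) \<and> (AE x in \<mu>. g x = (\<Sum>u\<in>U. h u x))}"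
      then obtain h where g: "g \<in> borel_measurable \<mu>"
        and h: "\<forall>u\<in>U. h u \<in> ae_span \<mu> (e u ` I u)" and ae: "AE x in \<mu>. g x = (\<Sum>u\<in>U. h u x)"
        by auto
      have "\<forall>u\<in>U. \<exists>c. AE x in \<mu>. h u x = (\<Sum>i\<in>I u. c i * e u i x)"
        using h iff by blast
      then obtain c where "\<forall>u\<in>U. AE x in \<mu>. h u x = (\<Sum>i\<in>I u. c u i * e u i x)"
        by (auto dest: bchoice)
      hence "AE x in \<mu>. \<forall>u\<in>U. h u x = (\<Sum>i\<in>I u. c u i * e u i x)"
        using assms(1) by (simp add: AE_finite_all)
      with ae have "AE x in \<mu>. g x = (\<Sum>u\<in>U. \<Sum>i\<in>I u. c u i * e u i x)"
        by eventually_elim simp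
      with g show "g \<in> ae_span \<mu> ((\<lambda>(u, i). e u i) ` Sigma U I)"
        unfolding ae_span_image_iff[OF fin] sig by (intro conjI exI[of _ "case_prod c"]) auto
    qed
  qed
qed

section \<open>Tensor products and product measures\<close>

lemma measurable_tensor_product:
  assumes "finite u" and "u \<subseteq> J" and "\<And>k. k \<in> u \<Longrightarrow> h k \<in> borel_measurable (\<nu> k)"
  shows "(\<lambda>x. \<Prod>k\<in>u. h k (x k) :: real) \<in> borel_measurable (PiM J \<nu>)"
proof (rule borel_measurable_prod)
  fix k assume k: "k \<in> u"
  show "(\<lambda>x. h k (x k)) \<in> borel_measurable (PiM J \<nu>)"
    using k assms(2) by (intro measurable_compose[OF measurable_component_singleton, where g = "h k"] assms(3)) auto
qed

lemma tensor_cong: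
  assumes "\<And>k. k \<in> u \<Longrightarrow> V k = W k"
  shows "tensor \<mu> u V = tensor \<mu> u W"
proof -
  have "(\<forall>k\<in>u. h k \<in> V k) \<longleftrightarrow> (\<forall>k\<in>u. h k \<in> W k)" for h using assms by auto
  thus ?thesis unfolding tensor_def by simp
qed

lemma is_orthogonal_sum_cong:
  assumes "\<And>i. i \<in> I \<Longrightarrow> V i = W i"
  shows "is_orthogonal_sum \<mu> I V S \<longleftrightarrow> is_orthogonal_sum \<mu> I W S"
  using assms unfolding is_orthogonal_sum_def by (simp cong: ball_cong)

text \<open>
  If each factor of a product is almost everywhere a linear combination of generators, then
  expanding the product of sums writes it as a combination of products of generators. The null sets
  of the single coordinates lift to null sets of the product measure because all factors are
  probability measures. The measure lives on all coordinates in \<open>J\<close> while the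
  functions read only those in \<open>u\<close>; this covers both functions of \<open>x\<^sub>u\<close> and their extensions.
\<close>

lemma tensor_ae_span:
  assumes "finite u" and "u \<subseteq> J" and "\<And>k. k \<in> J \<Longrightarrow> prob_space (\<nu> k)"
    and fin: "\<And>k. k \<in> u \<Longrightarrow> finite (I k)"
    and meas: "\<And>k i. k \<in> u \<Longrightarrow> i \<in> I k \<Longrightarrow> e k i \<in> borel_measurable (\<nu> k)"
  shows "tensor (PiM J \<nu>) u (\<lambda>k. ae_span (\<nu> k) (e k ` I k)) =
    ae_span (PiM J \<nu>) ((\<lambda>i x. \<Prod>k\<in>u. e k (i k) (x k)) ` PiE u I)" (is "_ = ae_span _ ?B")
proof -
  have finE: "finite (PiE u I)" using assms(1) fin by (rule finite_PiE)
  have "(\<lambda>x. \<Prod>k\<in>u. h k (x k)) \<in> ae_span (PiM J \<nu>) ?B"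
    if h: "\<And>k. k \<in> u \<Longrightarrow> h k \<in> ae_span (\<nu> k) (e k ` I k)" for h
  proof -
    have "\<forall>k\<in>u. \<exists>c. AE y in \<nu> k. h k y = (\<Sum>i\<in>I k. c i * e k i y)"
      using h ae_span_image_iff[OF fin] by blast
    from bchoice[OF this] obtain c
      where c: "\<And>k. k \<in> u \<Longrightarrow> AE y in \<nu> k. h k y = (\<Sum>i\<in>I k. c k i * e k i y)"
      by blast
    have "AE x in PiM J \<nu>. \<forall>k\<in>u. h k (x k) = (\<Sum>i\<in>I k. c k i * e k i (x k))"
      using assms(1)
    proof (rule AE_finite_allI)
      fix k assume k: "k \<in> u"
      show "AE x in PiM J \<nu>. h k (x k) = (\<Sum>i\<in>I k. c k i * e k i (x k))"
        by (rule AE_PiM_component[where P = "\<lambda>y. h k y = (\<Sum>i\<in>I k. c k i * e k i y)"])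
           (use k assms(2,3) c in auto)
    qed
    hence "AE x in PiM J \<nu>. (\<Prod>k\<in>u. h k (x k)) =
        (\<Sum>i\<in>PiE u I. (\<Prod>k\<in>u. c k (i k)) * (\<Prod>k\<in>u. e k (i k) (x k)))"
    proof eventually_elim
      case (elim x)
      have "(\<Prod>k\<in>u. h k (x k)) = (\<Prod>k\<in>u. \<Sum>i\<in>I k. c k i * e k i (x k))"
        using elim by (intro prod.cong) auto
      also have "\<dots> = (\<Sum>i\<in>PiE u I. \<Prod>k\<in>u. c k (i k) * e k (i k) (x k))"
        using assms(1) fin by (rule prod_sum_PiE)
      finally show ?case by (simp add: prod.distrib)
    qed
    moreover have "(\<lambda>x. \<Prod>k\<in>u. h k (x k)) \<in> borel_measurable (PiM J \<nu>)"
      using assms(1,2) h by (intro measurable_tensor_product) (auto simp: ae_span_def)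
    ultimately show ?thesis unfolding ae_span_image_iff[OF finE]
      by (intro conjI exI[of _ "\<lambda>i. \<Prod>k\<in>u. c k (i k)"])
  qed
  hence "tensor (PiM J \<nu>) u (\<lambda>k. ae_span (\<nu> k) (e k ` I k)) \<subseteq> ae_span (PiM J \<nu>) ?B"
    unfolding tensor_def using finE by (intro ae_span_minimal) auto
  moreover have "?B \<subseteq> {\<lambda>x. \<Prod>k\<in>u. h k (x k) | h. \<forall>k\<in>u. h k \<in> ae_span (\<nu> k) (e k ` I k)}"
  proof
    fix g assume "g \<in> ?B"
    then obtain i where "i \<in> PiE u I" "g = (\<lambda>x. \<Prod>k\<in>u. e k (i k) (x k))" by auto
    moreover from this have "\<forall>k\<in>u. e k (i k) \<in> ae_span (\<nu> k) (e k ` I k)"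
      using meas by (auto intro!: ae_span_generator)
    ultimately show "g \<in> {\<lambda>x. \<Prod>k\<in>u. h k (x k) | h. \<forall>k\<in>u. h k \<in> ae_span (\<nu> k) (e k ` I k)}"
      by (intro CollectI exI[of _ "\<lambda>k. e k (i k)"]) auto
  qed
  hence "ae_span (PiM J \<nu>) ?B \<subseteq> tensor (PiM J \<nu>) u (\<lambda>k. ae_span (\<nu> k) (e k ` I k))"
    unfolding tensor_def by (rule ae_span_mono)
  ultimately show ?thesis by (rule equalityI)
qed

text \<open>
  Replacing the factors outside \<open>J\<close> by trivial measures turns the hypotheses on \<open>J\<close> into
  the global hypotheses of the locale \<open>product_sigma_finite\<close>.
\<close>

lemma PiM_prod_integrable_integral:
  fixes h :: "'i \<Rightarrow> 'a \<Rightarrow> real"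
  assumes "finite J" and "\<And>k. k \<in> J \<Longrightarrow> prob_space (\<nu> k)"
    and "\<And>k. k \<in> J \<Longrightarrow> integrable (\<nu> k) (h k)"
  shows "integrable (PiM J \<nu>) (\<lambda>x. \<Prod>k\<in>J. h k (x k))"
    and "(\<integral>x. (\<Prod>k\<in>J. h k (x k)) \<partial>PiM J \<nu>) = (\<Prod>k\<in>J. \<integral>y. h k y \<partial>\<nu> k)"
proof -
  define M where "M k = (if k \<in> J then \<nu> k else count_space {})" for k
  have "sigma_finite_measure (M k)" for k
    using assms(2)[of k] by (auto simp: M_def prob_space_imp_sigma_finite sigma_finite_measure_count_space_finite)
  then interpret product_sigma_finite M by (simp add: product_sigma_finite_def)
  have eq: "PiM J \<nu> = PiM J M" by (intro PiM_cong) (auto simp: M_def)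
  have int: "integrable (M k) (h k)" if "k \<in> J" for k using that assms(3) by (simp add: M_def)
  show "integrable (PiM J \<nu>) (\<lambda>x. \<Prod>k\<in>J. h k (x k))"
    unfolding eq using assms(1) int by (rule product_integrable_prod)
  show "(\<integral>x. (\<Prod>k\<in>J. h k (x k)) \<partial>PiM J \<nu>) = (\<Prod>k\<in>J. \<integral>y. h k y \<partial>\<nu> k)"
  proof -
    have "(\<integral>x. (\<Prod>k\<in>J. h k (x k)) \<partial>PiM J M) = (\<Prod>k\<in>J. \<integral>y. h k y \<partial>M k)"
      using assms(1) int by (rule product_integral_prod)
    also have "\<dots> = (\<Prod>k\<in>J. \<integral>y. h k y \<partial>\<nu> k)" by (intro prod.cong) (auto simp: M_def)
    finally show ?thesis unfolding eq .
  qed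
qed

text \<open>
  A measure on a finite product is determined by its values on boxes, where the integral of the
  product density factorizes. Factors outside \<open>u\<close>, where nothing is known about \<open>f\<close>, are replaced by
  Lebesgue measures on the intervals.
\<close>

lemma joint_measure_eq_PiM:
  assumes "finite u" and "\<And>k x. k \<in> u \<Longrightarrow> 0 \<le> f k x"
    and "\<And>k. k \<in> u \<Longrightarrow> f k \<in> borel_measurable borel"
    and "\<And>k. k \<in> u \<Longrightarrow> prob_space (uni_measure (a k) (b k) (f k))"
  shows "joint_measure a b f u = PiM u (\<lambda>k. uni_measure (a k) (b k) (f k))"
proof -
  define L where "L k = restrict_space lborel {a k..b k}" for k
  define M where "M k = (if k \<in> u then uni_measure (a k) (b k) (f k) else L k)" for k
  have L: "sigma_finite_measure (L k)" for k
    unfolding L_def by (intro sigma_finite_measure_restrict_space sigma_finite_lborel) auto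
  interpret L: product_sigma_finite L using L by (simp add: product_sigma_finite_def)
  have "sigma_finite_measure (M k)" for k
    using assms(4)[of k] L by (auto simp: M_def prob_space_imp_sigma_finite)
  then interpret M: product_sigma_finite M by (simp add: product_sigma_finite_def)
  have sets: "sets (M k) = sets (L k)" for k by (simp add: M_def uni_measure_def L_def)
  have meas: "f k \<in> borel_measurable (L k)" if "k \<in> u" for k
    using assms(3)[OF that] unfolding L_def by (intro measurable_restrict_space1) simp
  have "joint_measure a b f u = PiM u M"
    unfolding joint_measure_def L_def[symmetric]
  proof (rule M.PiM_eqI[OF assms(1)])
    show "sets (density (PiM u L) (\<lambda>x. ennreal (\<Prod>k\<in>u. f k (x k)))) = sets (PiM u M)"
      using sets by (simp cong: sets_PiM_cong)
  next
    fix A assume "\<And>k. k \<in> u \<Longrightarrow> A k \<in> sets (M k)"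
    hence A: "\<And>k. k \<in> u \<Longrightarrow> A k \<in> sets (L k)" by (simp add: sets)
    have box: "PiE u A \<in> sets (PiM u L)" using assms(1) A by (intro sets_PiM_I_finite) auto
    have "(\<lambda>x. \<Prod>k\<in>u. f k (x k)) \<in> borel_measurable (PiM u L)"
      using assms(1) meas by (intro measurable_tensor_product) auto
    hence "emeasure (density (PiM u L) (\<lambda>x. ennreal (\<Prod>k\<in>u. f k (x k)))) (PiE u A) =
        (\<integral>\<^sup>+x. ennreal (\<Prod>k\<in>u. f k (x k)) * indicator (PiE u A) x \<partial>PiM u L)"
      using box by (intro emeasure_density) auto
    also have "\<dots> = (\<integral>\<^sup>+x. (\<Prod>k\<in>u. ennreal (f k (x k)) * indicator (A k) (x k)) \<partial>PiM u L)"
    proof (rule nn_integral_cong)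
      fix x assume x: "x \<in> space (PiM u L)"
      have "indicator (PiE u A) x = (\<Prod>k\<in>u. indicator (A k) (x k) :: ennreal)"
        using x assms(1) by (auto simp: indicator_def space_PiM PiE_iff prod_zero_iff)
      thus "ennreal (\<Prod>k\<in>u. f k (x k)) * indicator (PiE u A) x =
          (\<Prod>k\<in>u. ennreal (f k (x k)) * indicator (A k) (x k))"
        using assms(2) by (simp add: prod.distrib prod_ennreal)
    qed
    also have "\<dots> = (\<Prod>k\<in>u. \<integral>\<^sup>+y. ennreal (f k y) * indicator (A k) y \<partial>L k)"
      using assms(1) meas A by (intro L.product_nn_integral_prod) auto
    also have "\<dots> = (\<Prod>k\<in>u. emeasure (M k) (A k))"
      using meas A by (intro prod.cong refl)
        (auto simp: M_def uni_measure_def L_def[symmetric] emeasure_density)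
    finally show "emeasure (density (PiM u L) (\<lambda>x. ennreal (\<Prod>k\<in>u. f k (x k)))) (PiE u A) =
        (\<Prod>k\<in>u. emeasure (M k) (A k))" .
  qed
  also have "\<dots> = PiM u (\<lambda>k. uni_measure (a k) (b k) (f k))"
    by (intro PiM_cong) (auto simp: M_def)
  finally show ?thesis .
qed

section \<open>Products of orthonormal univariate families\<close>

locale orthonormal_factors =
  fixes J :: "nat set" and \<nu> :: "nat \<Rightarrow> real measure" and \<phi> :: "nat \<Rightarrow> nat \<Rightarrow> real \<Rightarrow> real"
    and n :: "nat \<Rightarrow> nat"
  assumes finite_J: "finite J"
    and prob: "\<And>k. k \<in> J \<Longrightarrow> prob_space (\<nu> k)"
    and n_pos: "\<And>k. k \<in> J \<Longrightarrow> 1 \<le> n k"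
    and first_factor: "\<And>k. k \<in> J \<Longrightarrow> \<phi> k 1 = (\<lambda>_. 1)"
    and measurable_factor: "\<And>k i. k \<in> J \<Longrightarrow> i \<in> {1..n k} \<Longrightarrow> \<phi> k i \<in> borel_measurable (\<nu> k)"
    and integrable_factors: "\<And>k i j. k \<in> J \<Longrightarrow> i \<in> {1..n k} \<Longrightarrow> j \<in> {1..n k} \<Longrightarrow>
      integrable (\<nu> k) (\<lambda>y. \<phi> k i y * \<phi> k j y)"
    and orthonormal: "\<And>k i j. k \<in> J \<Longrightarrow> i \<in> {1..n k} \<Longrightarrow> j \<in> {1..n k} \<Longrightarrow>
      (\<integral>y. \<phi> k i y * \<phi> k j y \<partial>\<nu> k) = (if i = j then 1 else 0)"
begin

definition product :: "nat set \<Rightarrow> (nat \<Rightarrow> nat) \<Rightarrow> (nat \<Rightarrow> real) \<Rightarrow> real" where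
  "product u i x = (\<Prod>k\<in>u. \<phi> k (i k) (x k))"

definition reduced :: "nat set \<Rightarrow> (nat \<Rightarrow> nat) set" where
  "reduced u = PiE u (\<lambda>k. {2..n k})"

text \<open>
  The relabelling behind the decomposition: an index tuple on \<open>u\<close> with entries at least 2 becomes an
  index tuple on all of \<open>J\<close> by inserting the index 1 of the constant function outside \<open>u\<close>.
\<close>

definition extend :: "nat set \<Rightarrow> (nat \<Rightarrow> nat) \<Rightarrow> nat \<Rightarrow> nat" where
  "extend u i k = (if k \<in> u then i k else 1)"

lemma finite_reduced: "u \<subseteq> J \<Longrightarrow> finite (reduced u)"
  unfolding reduced_def by (intro finite_PiE) (auto intro: finite_subset[OF _ finite_J])

lemma extend_in_range:
  assumes "i \<in> reduced u" and "k \<in> J"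
  shows "extend u i k \<in> {1..n k}"
proof (cases "k \<in> u")
  case True
  hence "i k \<in> {2..n k}" using assms(1) unfolding reduced_def by (rule PiE_mem[rotated])
  with True show ?thesis by (simp add: extend_def)
next
  case False
  with assms(2) n_pos[of k] show ?thesis by (simp add: extend_def)
qed

lemma product_extend:
  assumes "u \<subseteq> J"
  shows "product u i x = (\<Prod>k\<in>J. \<phi> k (extend u i k) (x k))"
  unfolding product_def extend_def using assms finite_J first_factor
  by (intro prod.mono_neutral_cong_left) auto

text \<open>
  The set \<open>u\<close> is recovered from the extended tuple as the set of coordinates with an index other than 1.
\<close>

lemma extend_inject:
  assumes "i \<in> reduced u" and "j \<in> reduced v" and "u \<subseteq> J" and "v \<subseteq> J"
  shows "(\<forall>k\<in>J. extend u i k = extend v j k) \<longleftrightarrow> u = v \<and> i = j"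
proof
  assume eq: "\<forall>k\<in>J. extend u i k = extend v j k"
  have recover: "w = {k \<in> J. extend w l k \<noteq> 1}" if "l \<in> reduced w" "w \<subseteq> J" for w l
    using that by (force simp: extend_def reduced_def PiE_iff)
  have "u = {k \<in> J. extend u i k \<noteq> 1}" by (rule recover[OF assms(1,3)])
  also have "\<dots> = {k \<in> J. extend v j k \<noteq> 1}" using eq by auto
  also have "\<dots> = v" by (rule recover[OF assms(2,4), symmetric])
  finally have "u = v" .
  have "i = j"
  proof (rule PiE_ext)
    show "i \<in> PiE u (\<lambda>k. {2..n k})" "j \<in> PiE u (\<lambda>k. {2..n k})"
      using assms(1,2) \<open>u = v\<close> by (auto simp: reduced_def)
    show "i k = j k" if "k \<in> u" for k
    proof -
      have "extend u i k = extend v j k" using eq that assms(3) by blast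
      thus ?thesis using that \<open>u = v\<close> by (simp add: extend_def)
    qed
  qed
  with \<open>u = v\<close> show "u = v \<and> i = j" ..
qed auto

text \<open>
  After extension by constants both products run over all of \<open>J\<close>, so the integral factorizes into
  Kronecker deltas, one for each coordinate.
\<close>

lemma product_orthonormal:
  assumes "u \<subseteq> J" and "v \<subseteq> J" and "i \<in> reduced u" and "j \<in> reduced v"
  shows "integrable (PiM J \<nu>) (\<lambda>x. product u i x * product v j x)"
    and "(\<integral>x. product u i x * product v j x \<partial>PiM J \<nu>) = (if u = v \<and> i = j then 1 else 0)"
proof -
  let ?h = "\<lambda>k y. \<phi> k (extend u i k) y * \<phi> k (extend v j k) y"
  have eq: "product u i x * product v j x = (\<Prod>k\<in>J. ?h k (x k))" for x
    using assms by (simp add: product_extend prod.distrib)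
  have int: "integrable (\<nu> k) (?h k)" if "k \<in> J" for k
    using that assms extend_in_range by (intro integrable_factors) auto
  show "integrable (PiM J \<nu>) (\<lambda>x. product u i x * product v j x)"
    unfolding eq using finite_J prob int by (rule PiM_prod_integrable_integral(1))
  have "(\<integral>x. product u i x * product v j x \<partial>PiM J \<nu>) = (\<Prod>k\<in>J. \<integral>y. ?h k y \<partial>\<nu> k)"
    unfolding eq using finite_J prob int by (rule PiM_prod_integrable_integral(2))
  also have "\<dots> = (\<Prod>k\<in>J. if extend u i k = extend v j k then 1 else 0)"
    using assms extend_in_range by (intro prod.cong refl orthonormal) auto
  also have "\<dots> = (if \<forall>k\<in>J. extend u i k = extend v j k then 1 else 0)"
    using finite_J by (auto simp: prod_zero_iff)
  also have "\<dots> = (if u = v \<and> i = j then 1 else 0)"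
    by (simp only: extend_inject[OF assms(3,4,1,2)])
  finally show "(\<integral>x. product u i x * product v j x \<partial>PiM J \<nu>) = (if u = v \<and> i = j then 1 else 0)" .
qed

lemma measurable_product:
  assumes "u \<subseteq> J" and "i \<in> reduced u"
  shows "product u i \<in> borel_measurable (PiM J \<nu>)"
  unfolding product_def
proof (rule measurable_tensor_product)
  show "\<phi> k (i k) \<in> borel_measurable (\<nu> k)" if "k \<in> u" for k
    using that assms by (intro measurable_factor) (force simp: reduced_def)+
qed (use assms finite_J in \<open>auto intro: finite_subset\<close>)

lemma full_products: "(\<lambda>i x. \<Prod>k\<in>J. \<phi> k (i k) (x k)) ` PiE J (\<lambda>k. {1..n k}) = (\<Union>u\<in>Pow J. product u ` reduced u)"
proof (intro subset_antisym subsetI)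
  fix g assume "g \<in> (\<lambda>i x. \<Prod>k\<in>J. \<phi> k (i k) (x k)) ` PiE J (\<lambda>k. {1..n k})"
  then obtain i where i: "i \<in> PiE J (\<lambda>k. {1..n k})" and g: "g = (\<lambda>x. \<Prod>k\<in>J. \<phi> k (i k) (x k))" by auto
  define u where "u = {k \<in> J. i k \<noteq> 1}"
  have "restrict i u \<in> reduced u" using i by (fastforce simp: reduced_def u_def PiE_iff)
  moreover have "g = product u (restrict i u)"
  proof
    fix x
    have "product u (restrict i u) x = (\<Prod>k\<in>J. \<phi> k (extend u (restrict i u) k) (x k))"
      by (rule product_extend) (auto simp: u_def)
    also have "\<dots> = g x" unfolding g by (intro prod.cong refl) (auto simp: extend_def u_def)
    finally show "g x = product u (restrict i u) x" ..
  qed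
  ultimately show "g \<in> (\<Union>u\<in>Pow J. product u ` reduced u)" by (auto simp: u_def)
next
  fix g assume "g \<in> (\<Union>u\<in>Pow J. product u ` reduced u)"
  then obtain u i where u: "u \<subseteq> J" "i \<in> reduced u" "g = product u i" by auto
  have "g = (\<lambda>x. \<Prod>k\<in>J. \<phi> k (restrict (extend u i) J k) (x k))"
    unfolding u(3) by (auto simp: product_extend[OF u(1)])
  moreover have "restrict (extend u i) J \<in> PiE J (\<lambda>k. {1..n k})"
    using extend_in_range[OF u(2)] by auto
  ultimately show "g \<in> (\<lambda>i x. \<Prod>k\<in>J. \<phi> k (i k) (x k)) ` PiE J (\<lambda>k. {1..n k})" by blast
qed

lemma tensor_reduced:
  assumes "u \<subseteq> J"
  shows "tensor (PiM J \<nu>) u (\<lambda>k. ae_span (\<nu> k) (\<phi> k ` {2..n k})) = ae_span (PiM J \<nu>) (product u ` reduced u)"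
proof -
  have "product u ` reduced u = (\<lambda>i x. \<Prod>k\<in>u. \<phi> k (i k) (x k)) ` PiE u (\<lambda>k. {2..n k})"
    by (simp add: product_def[abs_def] reduced_def)
  thus ?thesis
    using assms prob finite_subset[OF assms finite_J] measurable_factor
    by (simp only:) (intro tensor_ae_span, auto)
qed

lemma reduced_basis: 
  assumes "u \<subseteq> J"
  shows "ae_basis (PiM J \<nu>) (reduced u) (product u) (ae_span (PiM J \<nu>) (product u ` reduced u))"
  using finite_reduced[OF assms] product_orthonormal[OF assms assms]
  by (intro orthonormal_ae_basis) auto

lemma full_tensor_orthogonal_sum:
  "is_orthogonal_sum (PiM J \<nu>) (Pow J) (\<lambda>u. ae_span (PiM J \<nu>) (product u ` reduced u))
     (tensor (PiM J \<nu>) J (\<lambda>k. ae_span (\<nu> k) (\<phi> k ` {1..n k})))"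
proof -
  have "tensor (PiM J \<nu>) J (\<lambda>k. ae_span (\<nu> k) (\<phi> k ` {1..n k})) =
      ae_span (PiM J \<nu>) ((\<lambda>i x. \<Prod>k\<in>J. \<phi> k (i k) (x k)) ` PiE J (\<lambda>k. {1..n k}))"
    using finite_J prob measurable_factor by (intro tensor_ae_span) auto
  also have "\<dots> = ae_span (PiM J \<nu>) (\<Union>u\<in>Pow J. product u ` reduced u)"
    by (simp only: full_products)
  finally show ?thesis
    using finite_J finite_reduced measurable_product product_orthonormal
    by (simp only:) (intro orthogonal_blocks_orthogonal_sum, auto)
qed

end

section \<open>Orthonormalized B-splines of one variable\<close>

locale spline_input =
  fixes M :: "'w measure" and Y :: "'w \<Rightarrow> real" and a b :: real and f :: "real \<Rightarrow> real"
    and \<xi> :: "nat \<Rightarrow> real" and p n :: nat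
  assumes prob_M: "prob_space M"
    and range_Y: "\<And>\<omega>. \<omega> \<in> space M \<Longrightarrow> Y \<omega> \<in> {a..b}"
    and f_nonneg: "\<And>x. 0 \<le> f x"
    and density_Y: "distributed M lborel Y (\<lambda>x. ennreal (f x))"
    and f_continuous: "continuous_on {a..b} f"
    and f_support: "closure {x. f x \<noteq> 0} = {a..b}"
    and knots: "open_knots p n a b \<xi>"
begin

abbreviation \<nu> :: "real measure" where "\<nu> \<equiv> uni_measure a b f"
abbreviation G :: "real mat" where "G \<equiv> moment_mat M Y \<xi> p n"
abbreviation Q :: "real mat" where "Q \<equiv> cholesky G"
abbreviation R :: "real mat" where "R \<equiv> the (mat_inverse Q)"
abbreviation \<psi> :: "nat \<Rightarrow> real \<Rightarrow> real" where "\<psi> \<equiv> psi M Y \<xi> p n"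

definition P :: "nat \<Rightarrow> real \<Rightarrow> real" where
  "P j x = (if j = 0 then 1 else bspline \<xi> p (j + 1) x)"

lemma n_pos: "0 < n" using knots by (simp add: open_knots_def)

lemma measurable_f [measurable]: "f \<in> borel_measurable borel"
  using distributed_real_measurable[OF _ density_Y] f_nonneg by simp

lemma measurable_Y_restrict: "Y \<in> measurable M (restrict_space lborel {a..b})"
  using range_Y distributed_measurable[OF density_Y] by (intro measurable_restrict_space2) auto

text \<open>
  Since \<open>Y\<close> takes its values in \<open>[a, b]\<close>, its law has all its mass there. This turns the
  moments in \<open>G\<close>, which are expectations, into integrals over the interval.
\<close>

lemma uni_measure_eq_distr: "\<nu> = distr M (restrict_space lborel {a..b}) Y"
proof (rule measure_eqI)
  have f: "(\<lambda>x. ennreal (f x)) \<in> borel_measurable (restrict_space lborel {a..b})"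
    by (intro measurable_restrict_space1) simp
  fix A assume "A \<in> sets \<nu>"
  hence A: "A \<in> sets (restrict_space lborel {a..b})" by (simp add: uni_measure_def)
  hence A': "A \<subseteq> {a..b}" "A \<in> sets lborel" by (auto simp: sets_restrict_space_iff)
  have "emeasure \<nu> A = (\<integral>\<^sup>+x. ennreal (f x) * indicator A x \<partial>restrict_space lborel {a..b})"
    unfolding uni_measure_def by (rule emeasure_density[OF f A])
  also have "\<dots> = (\<integral>\<^sup>+x. ennreal (f x) * indicator A x * indicator {a..b} x \<partial>lborel)"
    by (rule nn_integral_restrict_space) simp
  also have "\<dots> = (\<integral>\<^sup>+x. ennreal (f x) * indicator A x \<partial>lborel)"
    using A'(1) by (intro nn_integral_cong) (auto simp: indicator_def)
  also have "\<dots> = emeasure M (Y -` A \<inter> space M)"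
    using distributed_emeasure[OF density_Y A'(2)] by simp
  also have "\<dots> = emeasure (distr M (restrict_space lborel {a..b}) Y) A"
    by (rule emeasure_distr[OF measurable_Y_restrict A, symmetric])
  finally show "emeasure \<nu> A = emeasure (distr M (restrict_space lborel {a..b}) Y) A" .
qed (simp add: uni_measure_def)

lemma prob_space_uni_measure: "prob_space \<nu>"
  unfolding uni_measure_eq_distr by (rule prob_space.prob_space_distr[OF prob_M measurable_Y_restrict])

lemma measurable_uni_measure:
  assumes "g \<in> borel_measurable borel"
  shows "g \<in> borel_measurable \<nu>"
proof -
  have "g \<in> borel_measurable (restrict_space lborel {a..b})"
    using assms by (intro measurable_restrict_space1) simp
  thus ?thesis by (simp add: uni_measure_def)
qed

lemma integral_uni_measure:
  fixes g :: "real \<Rightarrow> real"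
  assumes "g \<in> borel_measurable borel"
  shows "(\<integral>\<omega>. g (Y \<omega>) \<partial>M) = (\<integral>x. g x \<partial>\<nu>)"
proof -
  have "g \<in> borel_measurable (restrict_space lborel {a..b})"
    using assms by (intro measurable_restrict_space1) simp
  from integral_distr[OF measurable_Y_restrict this] show ?thesis
    by (simp add: uni_measure_eq_distr)
qed

lemma integrable_uni_measure:
  fixes g :: "real \<Rightarrow> real"
  assumes "g \<in> borel_measurable borel" and "\<And>x. x \<in> {a..b} \<Longrightarrow> \<bar>g x\<bar> \<le> C"
  shows "integrable \<nu> g"
proof -
  interpret prob_space \<nu> by (rule prob_space_uni_measure)
  have "space \<nu> = {a..b}" by (simp add: uni_measure_def space_restrict_space)
  thus ?thesis
    using assms(2) measurable_uni_measure[OF assms(1)]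
    by (intro integrable_const_bound[of _ C]) auto
qed

lemma measurable_P [measurable]: "P j \<in> borel_measurable borel"
  by (cases "j = 0") (simp_all add: P_def[abs_def])

lemma bounded_P: "\<exists>C. \<forall>x\<in>{a..b}. \<bar>P j x\<bar> \<le> C"
  using bounded_bspline[of a b \<xi> p "j + 1"] by (cases "j = 0") (auto simp: P_def)

lemma integrable_P_P: "integrable \<nu> (\<lambda>x. P i x * P j x)"
proof -
  obtain C where C: "\<And>x. x \<in> {a..b} \<Longrightarrow> \<bar>P i x\<bar> \<le> C" using bounded_P by blast
  obtain D where D: "\<And>x. x \<in> {a..b} \<Longrightarrow> \<bar>P j x\<bar> \<le> D" using bounded_P by blast
  have "\<bar>P i x * P j x\<bar> \<le> C * D" if "x \<in> {a..b}" for x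
    unfolding abs_mult using C[OF that] D[OF that] by (intro mult_mono) auto
  thus ?thesis by (intro integrable_uni_measure) auto
qed

lemma aux_vec_index: "j < n \<Longrightarrow> vec_index (aux_vec \<xi> p n x) j = P j x"
  by (simp add: aux_vec_def P_def)

lemma G_carrier: "G \<in> carrier_mat n n"
  by (simp add: moment_mat_def)

lemma G_entry:
  assumes "i < n" and "j < n"
  shows "G $$ (i, j) = (\<integral>x. P i x * P j x \<partial>\<nu>)"
  using assms integral_uni_measure[of "\<lambda>x. P i x * P j x"]
  by (simp add: moment_mat_def aux_vec_index)

lemma AE_less_right_end: "AE x in \<nu>. a \<le> x \<and> x < b"
  unfolding AE_uni_measure_iff[OF measurable_f f_nonneg]
  using AE_lborel_singleton[of b] by eventually_elim auto

lemma sum_shift_to_one: "(\<Sum>j<n. h (j + 1)) = (\<Sum>i\<in>{1..n}. h i)" for h :: "nat \<Rightarrow> real"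
  by (rule sum.reindex_bij_witness[of _ "\<lambda>i. i - 1" "\<lambda>j. j + 1"]) auto

text \<open>
  Replacing \<open>B\<^sub>1\<close> by the constant is a change of basis: 1 is the sum of all B-splines, so the coefficient \<open>z 0\<close>
  of the constant is added to the coefficient of every \<open>B\<^sub>i\<close>. The right end point is excluded because
  all B-splines vanish there.
\<close>

lemma P_combination:
  assumes "a \<le> x" and "x < b"
  shows "(\<Sum>j<n. z j * P j x) =
    (\<Sum>i\<in>{1..n}. (if i = 1 then z 0 else z 0 + z (i - 1)) * bspline \<xi> p i x)"
proof -
  have one: "1 = (\<Sum>i\<in>{1..n}. bspline \<xi> p i x)"
    using bspline_partition_of_unity[OF knots assms] ..
  have "(\<Sum>j<n. z j * P j x) = z 0 * P 0 x + (\<Sum>j\<in>{..<n} - {0}. z j * P j x)"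
    using n_pos by (intro sum.remove) auto
  also have "(\<Sum>j\<in>{..<n} - {0}. z j * P j x) = (\<Sum>j<n. (if j = 0 then 0 else z j) * bspline \<xi> p (j + 1) x)"
    by (intro sum.mono_neutral_cong_left) (auto simp: P_def)
  also have "\<dots> = (\<Sum>i\<in>{1..n}. (if i = 1 then 0 else z (i - 1)) * bspline \<xi> p i x)"
    unfolding sum_shift_to_one[symmetric] by (intro sum.cong) auto
  also have "z 0 * P 0 x = (\<Sum>i\<in>{1..n}. z 0 * bspline \<xi> p i x)"
    by (simp only: sum_distrib_left[symmetric] one[symmetric]) (simp add: P_def)
  also have "(\<Sum>i\<in>{1..n}. z 0 * bspline \<xi> p i x) +
      (\<Sum>i\<in>{1..n}. (if i = 1 then 0 else z (i - 1)) * bspline \<xi> p i x) =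
      (\<Sum>i\<in>{1..n}. (if i = 1 then z 0 else z 0 + z (i - 1)) * bspline \<xi> p i x)"
    unfolding sum.distrib[symmetric] by (intro sum.cong) (auto simp: distrib_right)
  finally show ?thesis .
qed

lemma P_ae_independent:
  assumes "AE x in \<nu>. (\<Sum>j<n. z j * P j x) = 0" and "j < n"
  shows "z j = 0"
proof -
  have "AE x in \<nu>. (\<Sum>i\<in>{1..n}. (if i = 1 then z 0 else z 0 + z (i - 1)) * bspline \<xi> p i x) = 0"
    using assms(1) AE_less_right_end by eventually_elim (simp only: P_combination)
  hence zero: "(if i = 1 then z 0 else z 0 + z (i - 1)) = 0" if "i \<in> {1..n}" for i
    by (rule bspline_ae_independent[OF knots measurable_f f_nonneg f_continuous f_support _ that])
  have "z 0 = 0" using zero[of 1] n_pos by simp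
  with zero[of "j + 1"] assms(2) show ?thesis by (cases "j = 0") auto
qed

text \<open>
  The quadratic form is the second moment of \<open>\<Sum>j<n. z j * P j\<close>, which is 0 only if that function
  vanishes almost everywhere.
\<close>

lemma G_positive_definite:
  assumes "\<exists>i<n. z i \<noteq> 0"
  shows "0 < (\<Sum>i<n. \<Sum>j<n. z i * G $$ (i, j) * z j)"
proof -
  let ?S = "\<lambda>x. \<Sum>j<n. z j * P j x"
  have square: "(?S x)\<^sup>2 = (\<Sum>i<n. \<Sum>j<n. z i * z j * (P i x * P j x))" for x
    by (simp add: power2_eq_square sum_product ac_simps)
  have int: "integrable \<nu> (\<lambda>x. (?S x)\<^sup>2)"
    unfolding square using integrable_P_P by auto
  have "(\<Sum>i<n. \<Sum>j<n. z i * G $$ (i, j) * z j) = (\<integral>x. (?S x)\<^sup>2 \<partial>\<nu>)"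
    unfolding square using integrable_P_P
    by (simp add: Bochner_Integration.integral_sum G_entry ac_simps)
  moreover have "0 \<le> (\<integral>x. (?S x)\<^sup>2 \<partial>\<nu>)" by simp
  moreover have "(\<integral>x. (?S x)\<^sup>2 \<partial>\<nu>) \<noteq> 0"
  proof
    assume "(\<integral>x. (?S x)\<^sup>2 \<partial>\<nu>) = 0"
    hence "AE x in \<nu>. (?S x)\<^sup>2 = 0" using integral_nonneg_eq_0_iff_AE[OF int] by simp
    hence "AE x in \<nu>. ?S x = 0" by simp
    with assms show False using P_ae_independent by blast
  qed
  ultimately show ?thesis by linarith
qed

lemma is_cholesky_Q: "is_cholesky G Q"
proof (rule is_cholesky_cholesky[OF G_carrier])
  show "G $$ (i, j) = G $$ (j, i)" if "i < n" "j < n" for i j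
    using that by (simp add: G_entry mult.commute)
qed (rule G_positive_definite)

lemmas inverse_Q = inverse_cholesky_factor[OF is_cholesky_Q G_carrier]

lemma Q_carrier: "Q \<in> carrier_mat n n"
  using is_cholesky_Q G_carrier by (auto simp: is_cholesky_def)

lemma psi_eq_sum: 
  assumes "i < n"
  shows "\<psi> (i + 1) x = (\<Sum>j<n. R $$ (i, j) * P j x)"
  using assms inverse_Q(1) by (simp add: psi_def scalar_prod_def aux_vec_index aux_vec_def P_def lessThan_atLeast0)

lemma P_eq_sum_psi:
  assumes "j < n"
  shows "P j x = (\<Sum>i<n. Q $$ (j, i) * \<psi> (i + 1) x)"
proof -
  have "(\<Sum>i<n. Q $$ (j, i) * \<psi> (i + 1) x) = (\<Sum>i<n. \<Sum>k<n. Q $$ (j, i) * R $$ (i, k) * P k x)"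
    by (intro sum.cong refl) (subst psi_eq_sum, auto simp: sum_distrib_left mult.assoc)
  also have "\<dots> = (\<Sum>k<n. \<Sum>i<n. Q $$ (j, i) * R $$ (i, k) * P k x)" by (rule sum.swap)
  also have "\<dots> = (\<Sum>k<n. (Q * R) $$ (j, k) * P k x)"
    using assms inverse_Q(1) Q_carrier
    by (intro sum.cong refl) (simp add: scalar_prod_def lessThan_atLeast0 sum_distrib_right)
  also have "\<dots> = (\<Sum>k<n. if k = j then P k x else 0)"
    using assms by (intro sum.cong refl) (auto simp: inverse_Q(3))
  also have "\<dots> = P j x" using assms by simp
  finally show ?thesis ..
qed

text \<open>
  The first auxiliary function is the constant 1, whose second moment under a probability measure is
  1, so normalization does not change it.
\<close>

lemma psi_one: "\<psi> 1 = (\<lambda>_. 1)"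
proof
  fix x
  have G0: "G $$ (0, 0) = 1"
    using n_pos prob_space.prob_space[OF prob_space_uni_measure] by (simp add: G_entry P_def)
  have "\<psi> 1 x = row R 0 \<bullet> aux_vec \<xi> p n x"
    using inverse_Q(1) n_pos by (simp add: psi_def)
  also have "\<dots> = vec_index (aux_vec \<xi> p n x) 0"
    using n_pos by (simp add: inverse_Q(5)[OF n_pos G0] aux_vec_def)
  also have "\<dots> = 1" using n_pos by (simp add: aux_vec_index P_def)
  finally show "\<psi> 1 x = 1" .
qed

lemma measurable_psi:
  assumes "i \<in> {1..n}"
  shows "\<psi> i \<in> borel_measurable borel"
proof -
  have "\<psi> i = (\<lambda>x. \<Sum>j<n. R $$ (i - 1, j) * P j x)"
    using psi_eq_sum[of "i - 1"] assms by auto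
  thus ?thesis by simp
qed

lemma psi_orthonormal:
  assumes "i \<in> {1..n}" and "j \<in> {1..n}"
  shows "integrable \<nu> (\<lambda>x. \<psi> i x * \<psi> j x)"
    and "(\<integral>x. \<psi> i x * \<psi> j x \<partial>\<nu>) = (if i = j then 1 else 0)"
proof -
  define k l where "k = i - 1" and "l = j - 1"
  have kl: "k < n" "l < n" "i = k + 1" "j = l + 1" using assms by (auto simp: k_def l_def)
  have eq: "\<psi> i x * \<psi> j x = (\<Sum>r<n. \<Sum>s<n. R $$ (k, r) * R $$ (l, s) * (P r x * P s x))" for x
    unfolding kl(3,4) psi_eq_sum[OF kl(1)] psi_eq_sum[OF kl(2)] by (simp add: sum_product ac_simps)
  show "integrable \<nu> (\<lambda>x. \<psi> i x * \<psi> j x)" unfolding eq using integrable_P_P by auto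
  have "(\<integral>x. \<psi> i x * \<psi> j x \<partial>\<nu>) = (\<Sum>r<n. \<Sum>s<n. R $$ (k, r) * R $$ (l, s) * G $$ (r, s))"
    unfolding eq using integrable_P_P by (simp add: Bochner_Integration.integral_sum G_entry)
  also have "\<dots> = (\<Sum>s<n. \<Sum>r<n. R $$ (k, r) * R $$ (l, s) * G $$ (r, s))" by (rule sum.swap)
  also have "\<dots> = (\<Sum>s<n. (R * G) $$ (k, s) * R $$ (l, s))"
    using kl inverse_Q(1) G_carrier
    by (intro sum.cong refl)
      (simp add: scalar_prod_def lessThan_atLeast0 sum_distrib_left sum_distrib_right mult_ac)
  also have "\<dots> = (R * G * transpose_mat R) $$ (k, l)"
    using kl inverse_Q(1) G_carrier by (subst index_mult_mat) (auto simp: scalar_prod_def lessThan_atLeast0)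
  also have "\<dots> = (if i = j then 1 else 0)" using kl by (simp add: inverse_Q(4))
  finally show "(\<integral>x. \<psi> i x * \<psi> j x \<partial>\<nu>) = (if i = j then 1 else 0)" .
qed

lemma psi_span_eq_P_span: "ae_span \<nu> (\<psi> ` {1..n}) = ae_span \<nu> (P ` {..<n})"
proof (intro subset_antisym ae_span_minimal image_subsetI finite_imageI)
  fix i assume i: "i \<in> {1..n}"
  have "\<psi> i x = (\<Sum>j\<in>{..<n}. R $$ (i - 1, j) * P j x)" for x
    using psi_eq_sum[of "i - 1" x] i by (cases i) auto
  thus "\<psi> i \<in> ae_span \<nu> (P ` {..<n})"
    using measurable_uni_measure[OF measurable_psi[OF i]]
    by (subst ae_span_image_iff) (auto intro!: exI[of _ "\<lambda>j. R $$ (i - 1, j)"])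
next
  fix j assume j: "j \<in> {..<n}"
  have "P j x = (\<Sum>i\<in>{1..n}. Q $$ (j, i - 1) * \<psi> i x)" for x
    unfolding sum_shift_to_one[symmetric] using P_eq_sum_psi[of j] j by simp
  thus "P j \<in> ae_span \<nu> (\<psi> ` {1..n})"
    using measurable_uni_measure[OF measurable_P]
    by (subst ae_span_image_iff) (auto intro!: exI[of _ "\<lambda>i. Q $$ (j, i - 1)"])
qed auto

text \<open>
  The change of basis between \<open>B\<^sub>1, \<dots>, B\<^sub>n\<close> and \<open>1, B\<^sub>2, \<dots>, B\<^sub>n\<close>, in both directions through the partition of unity.
\<close>

lemma spline_space_eq_P_span: "spline_space a b f \<xi> p n = ae_span \<nu> (P ` {..<n})"
  unfolding spline_space_def
proof (intro subset_antisym ae_span_minimal image_subsetI finite_imageI)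
  fix i assume i: "i \<in> {1..n}"
  \<comment> \<open>\<open>B\<^sub>1 = 1 - B\<^sub>2 - \<dots> - B\<^sub>n\<close>, while every other \<open>B\<^sub>i\<close> is itself a generator.\<close>
  define z :: "nat \<Rightarrow> real" where "z j = (if i = 1 then (if j = 0 then 1 else - 1) else if j = i - 1 then 1 else 0)" for j
  have "AE x in \<nu>. bspline \<xi> p i x = (\<Sum>j<n. z j * P j x)"
    using AE_less_right_end
  proof eventually_elim
    case (elim x)
    have "(\<Sum>j<n. z j * P j x) = (\<Sum>k\<in>{1..n}. (if k = 1 then z 0 else z 0 + z (k - 1)) * bspline \<xi> p k x)"
      using elim by (intro P_combination) auto
    also have "\<dots> = (\<Sum>k\<in>{1..n}. if k = i then bspline \<xi> p k x else 0)"
      using i by (intro sum.cong refl) (auto simp: z_def)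
    finally show ?case using i by simp
  qed
  thus "bspline \<xi> p i \<in> ae_span \<nu> (P ` {..<n})"
    using measurable_uni_measure[OF measurable_bspline]
    by (subst ae_span_image_iff) auto
next
  fix j assume j: "j \<in> {..<n}"
  have "AE x in \<nu>. P j x = (\<Sum>i\<in>{1..n}. (if j = 0 then 1 else if i = j + 1 then 1 else 0) * bspline \<xi> p i x)"
    using AE_less_right_end
  proof eventually_elim
    case (elim x)
    show ?case
    proof (cases "j = 0")
      case True
      then show ?thesis using bspline_partition_of_unity[OF knots] elim by (simp add: P_def)
    next
      case False
      have "(\<Sum>i\<in>{1..n}. (if j = 0 then 1 else if i = j + 1 then 1 else 0) * bspline \<xi> p i x) =
          (\<Sum>i\<in>{1..n}. if i = j + 1 then bspline \<xi> p i x else 0)"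
        using False by (intro sum.cong) auto
      also have "\<dots> = bspline \<xi> p (j + 1) x" using j by (subst sum.delta) auto
      finally show ?thesis using False by (simp add: P_def)
    qed
  qed
  thus "P j \<in> ae_span \<nu> ((\<lambda>i. bspline \<xi> p i) ` {1..n})"
    using measurable_uni_measure[OF measurable_P]
    by (subst ae_span_image_iff)
      (auto intro!: exI[of _ "\<lambda>i. if j = 0 then 1 else if i = j + 1 then 1 else 0"])
qed auto

lemma spline_space_eq_psi_span: "spline_space a b f \<xi> p n = ae_span \<nu> (\<psi> ` {1..n})"
  by (simp only: spline_space_eq_P_span psi_span_eq_P_span)

end

section \<open>Decomposition of the multivariate spline space\<close>

theorem proposition4p4:
  fixes M :: "'w measure" and N :: nat and X :: "nat \<Rightarrow> 'w \<Rightarrow> real"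
    and a b :: "nat \<Rightarrow> real" and f :: "nat \<Rightarrow> real \<Rightarrow> real"
    and p n :: "nat \<Rightarrow> nat" and \<Xi> :: "nat \<Rightarrow> nat \<Rightarrow> real"
  assumes "prob_space M"
    and "N \<ge> 1"
    and "\<And>k. k \<in> {1..N} \<Longrightarrow> a k < b k"
    and "\<And>k \<omega>. k \<in> {1..N} \<Longrightarrow> \<omega> \<in> space M \<Longrightarrow> X k \<omega> \<in> {a k..b k}"
    and "prob_space.indep_vars M (\<lambda>_. borel) X {1..N}"
    and "\<And>k x. k \<in> {1..N} \<Longrightarrow> 0 \<le> f k x"
    and "\<And>k. k \<in> {1..N} \<Longrightarrow> distributed M lborel (X k) (\<lambda>x. ennreal (f k x))"
    and "\<And>k. k \<in> {1..N} \<Longrightarrow> continuous_on {a k..b k} (f k)"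
    and "\<And>k. k \<in> {1..N} \<Longrightarrow> closure {x. f k x \<noteq> 0} = {a k..b k}"
    and "\<And>k. k \<in> {1..N} \<Longrightarrow> open_knots (p k) (n k) (a k) (b k) (\<Xi> k)"
  shows "(\<forall>u. u \<noteq> {} \<and> u \<subseteq> {1..N} \<longrightarrow>
            ae_basis (joint_measure a b f u) (reduced_indices n u) (\<lambda>i. Psi M X \<Xi> p n u i)
              (reduced_spline_space M X a b f \<Xi> p n u) \<and>
            reduced_spline_space M X a b f \<Xi> p n u =
              ae_span (joint_measure a b f u) ((\<lambda>i. Psi M X \<Xi> p n u i) ` reduced_indices n u) \<and>
            ae_span (joint_measure a b f u) ((\<lambda>i. Psi M X \<Xi> p n u i) ` reduced_indices n u) =
              tensor (joint_measure a b f u) u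
                (\<lambda>k. ae_span (uni_measure (a k) (b k) (f k))
                       ((\<lambda>i. psi M (X k) (\<Xi> k) (p k) (n k) i) ` {2..n k})))
       \<and> is_orthogonal_sum (joint_measure a b f {1..N}) (Pow {1..N})
            (\<lambda>u. if u = {} then ae_span (joint_measure a b f {1..N}) {\<lambda>x. 1}
                 else ae_span (joint_measure a b f {1..N})
                        ((\<lambda>i. Psi M X \<Xi> p n u i) ` reduced_indices n u))
            (full_spline_space N a b f \<Xi> p n)
       \<and> is_orthogonal_sum (joint_measure a b f {1..N}) (Pow {1..N})
            (\<lambda>u. if u = {} then ae_span (joint_measure a b f {1..N}) {\<lambda>x. 1}
                 else tensor (joint_measure a b f {1..N}) u
                        (\<lambda>k. ae_span (uni_measure (a k) (b k) (f k))
                               ((\<lambda>i. psi M (X k) (\<Xi> k) (p k) (n k) i) ` {2..n k})))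
            (full_spline_space N a b f \<Xi> p n)"
proof -
  define \<nu> where "\<nu> k = uni_measure (a k) (b k) (f k)" for k
  define \<phi> where "\<phi> k = psi M (X k) (\<Xi> k) (p k) (n k)" for k
  have input: "spline_input M (X k) (a k) (b k) (f k) (\<Xi> k) (p k) (n k)" if "k \<in> {1..N}" for k
    using assms(1,4,6-10) that by (simp add: spline_input_def)
  have factors: "orthonormal_factors u \<nu> \<phi> n" if "u \<subseteq> {1..N}" for u
  proof (rule orthonormal_factors.intro)
    show "finite u" using that by (rule finite_subset) simp
    fix k assume "k \<in> u"
    with that interpret input: spline_input M "X k" "a k" "b k" "f k" "\<Xi> k" "p k" "n k"
      by (intro input) blast
    show "prob_space (\<nu> k)" unfolding \<nu>_def by (rule input.prob_space_uni_measure)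
    show "1 \<le> n k" using input.n_pos by simp
    show "\<phi> k 1 = (\<lambda>_. 1)" unfolding \<phi>_def by (rule input.psi_one)
    fix i assume i: "i \<in> {1..n k}"
    show "\<phi> k i \<in> borel_measurable (\<nu> k)"
      unfolding \<phi>_def \<nu>_def by (rule input.measurable_uni_measure[OF input.measurable_psi[OF i]])
    fix j assume j: "j \<in> {1..n k}"
    show "integrable (\<nu> k) (\<lambda>y. \<phi> k i y * \<phi> k j y)"
      and "(\<integral>y. \<phi> k i y * \<phi> k j y \<partial>\<nu> k) = (if i = j then 1 else 0)"
      unfolding \<phi>_def \<nu>_def using input.psi_orthonormal[OF i j] by auto
  qed
  have joint: "joint_measure a b f u = PiM u \<nu>" if "u \<subseteq> {1..N}" for u
    unfolding \<nu>_def
  proof (rule joint_measure_eq_PiM)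
    show "finite u" using that by (rule finite_subset) simp
    fix k assume "k \<in> u"
    with that have k: "k \<in> {1..N}" by auto
    then interpret input: spline_input M "X k" "a k" "b k" "f k" "\<Xi> k" "p k" "n k" by (rule input)
    show "f k \<in> borel_measurable borel" by (rule input.measurable_f)
    show "prob_space (uni_measure (a k) (b k) (f k))" by (rule input.prob_space_uni_measure)
    show "0 \<le> f k x" for x by (rule input.f_nonneg)
  qed
  interpret full: orthonormal_factors "{1..N}" \<nu> \<phi> n by (rule factors) simp
  have Psi: "(\<lambda>i. Psi M X \<Xi> p n u i) = full.product u" for u
    by (simp add: fun_eq_iff Psi_def full.product_def \<phi>_def)
  have indices: "reduced_indices n u = full.reduced u" for u
    by (simp add: reduced_indices_def full.reduced_def)
  have "ae_basis (joint_measure a b f u) (reduced_indices n u) (\<lambda>i. Psi M X \<Xi> p n u i)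
          (reduced_spline_space M X a b f \<Xi> p n u) \<and>
        reduced_spline_space M X a b f \<Xi> p n u =
          ae_span (joint_measure a b f u) ((\<lambda>i. Psi M X \<Xi> p n u i) ` reduced_indices n u) \<and>
        ae_span (joint_measure a b f u) ((\<lambda>i. Psi M X \<Xi> p n u i) ` reduced_indices n u) =
          tensor (joint_measure a b f u) u
            (\<lambda>k. ae_span (uni_measure (a k) (b k) (f k))
                   ((\<lambda>i. psi M (X k) (\<Xi> k) (p k) (n k) i) ` {2..n k}))"
    if u: "u \<subseteq> {1..N}" for u
  proof -
    interpret part: orthonormal_factors u \<nu> \<phi> n using u by (rule factors)
    have "reduced_spline_space M X a b f \<Xi> p n u =
        tensor (PiM u \<nu>) u (\<lambda>k. ae_span (\<nu> k) (\<phi> k ` {2..n k}))"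
      by (simp add: reduced_spline_space_def psi_span_def joint[OF u] \<nu>_def \<phi>_def)
    moreover have "\<dots> = ae_span (PiM u \<nu>) (part.product u ` part.reduced u)"
      by (rule part.tensor_reduced) simp
    ultimately show ?thesis
      using part.reduced_basis[OF subset_refl]
      by (simp add: joint[OF u] Psi indices part.product_def[abs_def] full.product_def[abs_def]
          part.reduced_def full.reduced_def \<nu>_def[symmetric] \<phi>_def[symmetric])
  qed
  moreover have sum: "is_orthogonal_sum (PiM {1..N} \<nu>) (Pow {1..N})
      (\<lambda>u. ae_span (PiM {1..N} \<nu>) (full.product u ` full.reduced u)) (full_spline_space N a b f \<Xi> p n)"
  proof -
    have "full_spline_space N a b f \<Xi> p n =
        tensor (PiM {1..N} \<nu>) {1..N} (\<lambda>k. ae_span (\<nu> k) (\<phi> k ` {1..n k}))"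
      unfolding full_spline_space_def joint[OF subset_refl] \<nu>_def \<phi>_def
      by (rule tensor_cong) (rule spline_input.spline_space_eq_psi_span[OF input])
    with full.full_tensor_orthogonal_sum show ?thesis by simp
  qed
  \<comment> \<open>The empty product is the constant 1, so the summand of the constants is the case \<open>u = {}\<close>.\<close>
  moreover have empty: "full.product {} ` full.reduced {} = {\<lambda>x. 1}"
    by (auto simp: full.product_def[abs_def] full.reduced_def)
  have blocks: "(if u = {} then ae_span (PiM {1..N} \<nu>) {\<lambda>x. 1}
      else ae_span (PiM {1..N} \<nu>) (full.product u ` full.reduced u)) =
      ae_span (PiM {1..N} \<nu>) (full.product u ` full.reduced u)" for u
    by (simp add: empty)
  moreover have "is_orthogonal_sum (PiM {1..N} \<nu>) (Pow {1..N})
      (\<lambda>u. if u = {} then ae_span (PiM {1..N} \<nu>) {\<lambda>x. 1}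
        else ae_span (PiM {1..N} \<nu>) (full.product u ` full.reduced u)) (full_spline_space N a b f \<Xi> p n)"
    using sum by (simp only: blocks)
  moreover have "is_orthogonal_sum (PiM {1..N} \<nu>) (Pow {1..N})
      (\<lambda>u. if u = {} then ae_span (PiM {1..N} \<nu>) {\<lambda>x. 1}
        else tensor (PiM {1..N} \<nu>) u (\<lambda>k. ae_span (\<nu> k) (\<phi> k ` {2..n k}))) (full_spline_space N a b f \<Xi> p n)"
  proof (rule is_orthogonal_sum_cong[THEN iffD1, OF _ sum])
    fix u assume "u \<in> Pow {1..N}"
    hence "tensor (PiM {1..N} \<nu>) u (\<lambda>k. ae_span (\<nu> k) (\<phi> k ` {2..n k})) =
        ae_span (PiM {1..N} \<nu>) (full.product u ` full.reduced u)"
      by (intro full.tensor_reduced) simp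
    thus "ae_span (PiM {1..N} \<nu>) (full.product u ` full.reduced u) =
        (if u = {} then ae_span (PiM {1..N} \<nu>) {\<lambda>x. 1}
         else tensor (PiM {1..N} \<nu>) u (\<lambda>k. ae_span (\<nu> k) (\<phi> k ` {2..n k})))"
      by (cases "u = {}") (simp_all only: empty simp_thms if_True if_False)
  qed
  ultimately show ?thesis
    by (simp only: joint[OF subset_refl] Psi indices \<nu>_def[symmetric] \<phi>_def[symmetric]) blast
qed

end
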